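(* Let $m$ be a positive integer and, for $Q\ge 1$, let $$\mathfrak{F}_Q^{(m)}=\Big\{\tfrac{a}{q} : 0<a\le q\le Q,\ (a,q)=1,\ (q,m)=1\Big\}.$$ Then the pair correlation function $g_{(m)}$ of the sequence $(\mathfrak{F}_Q^{(m)})_Q$ (as $Q\to\infty$) exists, and for every $\lambda>0$ $$ g_{(m)}(\lambda)=\frac{\varphi(m)}{m}\cdot\frac{C_m}{\lambda^2}\sum_{1\le \Delta\le \frac{2\lambda}{C_m}}\varphi(\Delta)\,\frac{(\Delta,m)}{\varphi\big((\Delta,m)\big)}\,\log\frac{2\lambda}{C_m\Delta}, $$ where $$C_m=\frac{\varphi(m)}{\zeta(2)\,m}\prod_{p\mid m}\Big(1-\frac1{p^2}\Big)^{-1}=\frac{\varphi(m)}{m}\prod_{p\nmid m}\Big(1-\frac1{p^2}\Big)$$ (products over primes $p$).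
   Context: For a finite set $F\subseteq\mathbb{R}$ of cardinality $N(F)$ and an interval $I$, set $$\mathcal{G}_F(I)=\frac{1}{N(F)}\#\Big\{(x,y)\in F^2: y\neq x,\ y-x\in \tfrac{1}{N(F)}I+\mathbb{Z}\Big\}.$$ The pair correlation measure of an increasing family of finite sets $(F_n)$ is $\mathcal{G}(I)=\lim_n\mathcal{G}_{F_n}(I)$ (when the limit exists for every interval $I$). If $G(\lambda):=\mathcal{G}([0,\lambda])=\int_0^\lambda g(x)\,dx$ for all $\lambda>0$, then $g$ is called the pair correlation function of $(F_n)$. Here $\varphi$ is Euler's totient function, $\zeta$ the Riemann zeta function, and $(\Delta,m)$ denotes the gcd. *)

theory Defs
  imports "HOL-Analysis.Analysis" "HOL-Number_Theory.Totient"
begin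

definition pair_corr :: "real set \<Rightarrow> real set \<Rightarrow> real" where
  "pair_corr F I =
     1 / real (card F) *
     real (card {(x, y). x \<in> F \<and> y \<in> F \<and> y \<noteq> x \<and>
       (\<exists>t\<in>I. \<exists>k::int. y - x = 1 / real (card F) * t + of_int k)})"

text \<open>Intervals are bounded: for unbounded \<open>I\<close>, \<open>I / N + \<int>\<close> is all of \<open>\<real>\<close> (for \<open>N > 0\<close>), and
  the normalised count is \<open>N - 1\<close>. Open, closed, half-open and degenerate intervals are all allowed.\<close>

definition pair_correlation_measure :: "(nat \<Rightarrow> real set) \<Rightarrow> (real set \<Rightarrow> real) \<Rightarrow> bool" where
  "pair_correlation_measure F G \<longleftrightarrow>
     incseq F \<and> (\<forall>n. finite (F n)) \<and>
     (\<forall>I. is_interval I \<and> bounded I \<longrightarrow> (\<lambda>n. pair_corr (F n) I) \<longlonglongrightarrow> G I)"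

definition pair_correlation_function :: "(nat \<Rightarrow> real set) \<Rightarrow> (real \<Rightarrow> real) \<Rightarrow> bool" where
  "pair_correlation_function F g \<longleftrightarrow>
     (\<exists>G. pair_correlation_measure F G \<and>
       (\<forall>x>0. g absolutely_integrable_on {0..x} \<and> G {0..x} = integral {0..x} g))"

definition farey_coprime :: "nat \<Rightarrow> nat \<Rightarrow> real set" where
  "farey_coprime m Q =
     {real a / real q | a q. 0 < a \<and> a \<le> q \<and> q \<le> Q \<and> coprime a q \<and> coprime q m}"

text \<open>The Riemann zeta function on its half-line of convergence \<open>s > 1\<close>.\<close>

definition zeta :: "real \<Rightarrow> real" where
  "zeta s = (\<Sum>n. 1 / real (Suc n) powr s)"

definition C :: "nat \<Rightarrow> real" where
  "C m = real (totient m) / (zeta 2 * real m) *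
     (\<Prod>p | prime p \<and> p dvd m. inverse (1 - 1 / (real p)\<^sup>2))"

end

theory Submission
  imports Defs
begin

text \<open>
  Two fractions \<open>a / q < b / s\<close> with denominators at most \<open>n\<close> have distance \<open>D / (q s)\<close>, where \<open>D = b q - a s\<close>,
  and there are about \<open>C m n\<^sup>2 / 2\<close> fractions. So only boundedly many determinants \<open>D\<close> contribute at the scale of the
  mean spacing, and it suffices to count, for each fixed \<open>D\<close>, the pairs with \<open>q s > D n\<^sup>2 / c\<close>. Suppose first that
  only \<open>a / q\<close> is reduced. For fixed \<open>q\<close>, summing over \<open>s\<close> the number of units \<open>a\<close> modulo \<open>q\<close> with
  \<open>a s \<equiv> -D\<close> is a sieve problem with main term \<open>\<phi>(m)/m \<cdot> \<phi>(q)/q\<close> times the length of the \<open>s\<close>-interval and error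
  \<open>O(2\<^bsup>\<omega>(q)\<^esup>) = O(\<surd>q)\<close>; no exponential sums are needed. The mean value of \<open>\<phi>(q)/q\<close> over \<open>q\<close> coprime to \<open>m\<close> is
  \<open>C m\<close>, so the sum over \<open>q\<close> tends to an integral. Sorting these pairs by \<open>gcd b s\<close> and inducting on \<open>D\<close> isolates
  the pairs in which \<open>b / s\<close> is reduced too. Differentiating the resulting distribution function gives the formula.
\<close>

section \<open>Sieving by finitely many primes\<close>

text \<open>Dropping the reducedness of b / s keeps the sieve simple: b is then just (a s + D) / q,
  and for given q and s one counts unit solutions a of a congruence, a number that depends on s only
  through gcd s q. The price is paid when common factors are removed: dividing b and s by k shrinks
  the range of s but not that of q, so the counts carry separate ranges n and \<rho> n. The
  inequality D n^2 < c q s survives this division when D becomes D / k, and D / (c \<rho>) is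
  unchanged, so all terms of the recursion share one value of \<open>Phi\<close> and only a divisor
  sum identity remains. The constants come from the cardinality N ~ C n^2 / 2: a gap \<lambda> / N
  corresponds to c / n^2 with c = 2 \<lambda> / C. As N / n^2 only tends to C / 2, a fixed c gives
  intervals whose right end moves with n; the closed interval [0, \<lambda>] is reached by
  squeezing, which uses continuity of the limit. The same continuity rules out atoms and so yields
  all bounded intervals.\<close>

lemma sum_multiples_upto:
  fixes F :: "nat \<Rightarrow> real" and x :: real
  assumes "p > 0" "x \<ge> 0"
  shows "(\<Sum>n\<in>{n\<in>{1..nat \<lfloor>x\<rfloor>}. p dvd n}. F n) = (\<Sum>n\<in>{1..nat \<lfloor>x / real p\<rfloor>}. F (p * n))"
proof -
  have iff: "p * k \<le> nat \<lfloor>x\<rfloor> \<longleftrightarrow> k \<le> nat \<lfloor>x / real p\<rfloor>" for k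
    using assms by (simp add: le_nat_floor le_nat_iff le_floor_iff field_simps)
  have "{n\<in>{1..nat \<lfloor>x\<rfloor>}. p dvd n} = (\<lambda>n. p * n) ` {1..nat \<lfloor>x / real p\<rfloor>}"
  proof (intro equalityI subsetI)
    fix n assume n: "n \<in> {n\<in>{1..nat \<lfloor>x\<rfloor>}. p dvd n}"
    then obtain k where k: "n = p * k" by auto
    with n have "k \<ge> 1" "k \<le> nat \<lfloor>x / real p\<rfloor>" using iff[of k] by (auto simp: Suc_le_eq)
    with k show "n \<in> (\<lambda>n. p * n) ` {1..nat \<lfloor>x / real p\<rfloor>}" by auto
  next
    fix n assume "n \<in> (\<lambda>n. p * n) ` {1..nat \<lfloor>x / real p\<rfloor>}"
    then obtain k where k: "n = p * k" "k \<ge> 1" "k \<le> nat \<lfloor>x / real p\<rfloor>" by fastforce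
    with iff[of k] assms show "n \<in> {n\<in>{1..nat \<lfloor>x\<rfloor>}. p dvd n}" by (auto simp: Suc_le_eq)
  qed
  moreover have "inj_on (\<lambda>n. p * n) {1..nat \<lfloor>x / real p\<rfloor>}"
    using assms by (auto simp: inj_on_def)
  ultimately show ?thesis by (simp add: sum.reindex)
qed

text \<open>Adding a prime p subtracts \<open>c p\<close> times the sum over the multiples of p. As
  \<open>W (p * n) = W n\<close>, that sum is the old one at x / p, so the induction hypothesis
  applies twice and each prime at most doubles the error. The value \<open>c p = 1\<close> sieves p
  out; \<open>c p = 1 / p\<close> produces the factor of totient q / q at p.\<close>

lemma sum_sieve_weights:
  fixes c :: "nat \<Rightarrow> real" and x :: real
  assumes "finite S" "\<And>p. p \<in> S \<Longrightarrow> prime p" "\<And>p. p \<in> S \<Longrightarrow> 0 \<le> c p \<and> c p \<le> 1" "x \<ge> 0"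
  shows "\<bar>(\<Sum>n\<in>{1..nat \<lfloor>x\<rfloor>}. \<Prod>p\<in>S. if p dvd n then 1 - c p else 1) -
            x * (\<Prod>p\<in>S. 1 - c p / real p)\<bar> \<le> 2 ^ card S"
  using assms
proof (induction S arbitrary: x rule: finite_induct)
  case empty
  have "\<bar>real (nat \<lfloor>x\<rfloor>) - x\<bar> \<le> 1" using empty by linarith
  thus ?case by simp
next
  case (insert p S)
  define W where "W = (\<lambda>n. \<Prod>p\<in>S. if p dvd n then 1 - c p else (1::real))"
  define M where "M = (\<Prod>p\<in>S. 1 - c p / real p)"
  have p: "prime p" "0 \<le> c p" "c p \<le> 1" "real p \<ge> 1"
    using insert.prems(1)[of p] insert.prems(2)[of p] prime_ge_1_nat[of p] by auto
  have IH: "\<bar>(\<Sum>n\<in>{1..nat \<lfloor>y\<rfloor>}. W n) - y * M\<bar> \<le> 2 ^ card S" if "y \<ge> 0" for y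
    unfolding W_def M_def using insert.IH[of y] insert.prems that by auto
  have WM: "W (p * n) = W n" for n
    unfolding W_def
  proof (intro prod.cong refl)
    fix r assume r: "r \<in> S"
    hence "r \<noteq> p" "prime r" using insert by auto
    hence "r dvd p * n \<longleftrightarrow> r dvd n"
      using p by (metis prime_dvd_mult_iff primes_dvd_imp_eq)
    thus "(if r dvd p * n then 1 - c r else 1) = (if r dvd n then 1 - c r else 1)" by simp
  qed
  have "(\<Sum>n\<in>{1..nat \<lfloor>x\<rfloor>}. \<Prod>p\<in>insert p S. if p dvd n then 1 - c p else 1)
      = (\<Sum>n\<in>{1..nat \<lfloor>x\<rfloor>}. W n - c p * (if p dvd n then W n else 0))"
    using insert.hyps by (intro sum.cong refl) (auto simp: W_def algebra_simps)
  also have "\<dots> = (\<Sum>n\<in>{1..nat \<lfloor>x\<rfloor>}. W n) - c p * (\<Sum>n\<in>{n\<in>{1..nat \<lfloor>x\<rfloor>}. p dvd n}. W n)"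
    unfolding sum_subtractf sum_distrib_left[symmetric] by (subst sum.inter_filter) auto
  also have "(\<Sum>n\<in>{n\<in>{1..nat \<lfloor>x\<rfloor>}. p dvd n}. W n) = (\<Sum>n\<in>{1..nat \<lfloor>x / real p\<rfloor>}. W n)"
    using p insert.prems by (subst sum_multiples_upto) (auto simp: WM prime_gt_0_nat)
  finally have eq: "(\<Sum>n\<in>{1..nat \<lfloor>x\<rfloor>}. \<Prod>p\<in>insert p S. if p dvd n then 1 - c p else 1)
     = (\<Sum>n\<in>{1..nat \<lfloor>x\<rfloor>}. W n) - c p * (\<Sum>n\<in>{1..nat \<lfloor>x / real p\<rfloor>}. W n)" .
  have "(\<Prod>p\<in>insert p S. 1 - c p / real p) = M - c p / real p * M"
    using insert.hyps by (simp add: M_def algebra_simps)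
  hence "(\<Sum>n\<in>{1..nat \<lfloor>x\<rfloor>}. \<Prod>p\<in>insert p S. if p dvd n then 1 - c p else 1)
           - x * (\<Prod>p\<in>insert p S. 1 - c p / real p)
       = ((\<Sum>n\<in>{1..nat \<lfloor>x\<rfloor>}. W n) - x * M)
           - c p * ((\<Sum>n\<in>{1..nat \<lfloor>x / real p\<rfloor>}. W n) - x / real p * M)"
    unfolding eq by (simp only:) (simp add: algebra_simps)
  also have "\<bar>\<dots>\<bar> \<le> \<bar>(\<Sum>n\<in>{1..nat \<lfloor>x\<rfloor>}. W n) - x * M\<bar>
       + c p * \<bar>(\<Sum>n\<in>{1..nat \<lfloor>x / real p\<rfloor>}. W n) - x / real p * M\<bar>"
    using p by (intro order_trans[OF abs_triangle_ineq4]) (simp add: abs_mult)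
  also have "\<dots> \<le> 2 ^ card S + 1 * 2 ^ card S"
    using IH[of x] IH[of "x / real p"] insert.prems p
    by (intro add_mono mult_mono) auto
  finally show ?case using insert.hyps by simp
qed

lemma coprime_iff_no_common_prime:
  fixes n r :: nat
  assumes "r > 0"
  shows "coprime n r \<longleftrightarrow> (\<forall>p\<in>prime_factors r. \<not> p dvd n)"
proof
  assume "coprime n r"
  thus "\<forall>p\<in>prime_factors r. \<not> p dvd n"
    by (metis coprime_common_divisor in_prime_factors_iff not_prime_unit)
next
  assume *: "\<forall>p\<in>prime_factors r. \<not> p dvd n"
  show "coprime n r"
  proof (rule ccontr)
    assume "\<not> coprime n r"
    then obtain p where "prime p" "p dvd n" "p dvd r"
      by (metis coprime_iff_gcd_eq_1 gcd_greatest_iff prime_factor_nat)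
    with * assms show False by (auto simp: in_prime_factors_iff)
  qed
qed

lemma card_coprime_upto:
  fixes x :: real
  assumes "r > 0" "x \<ge> 0"
  shows "\<bar>real (card {n\<in>{1..nat \<lfloor>x\<rfloor>}. coprime n r}) - x * (real (totient r) / real r)\<bar>
           \<le> 2 ^ card (prime_factors r)"
proof -
  have "(\<Sum>n\<in>{1..nat \<lfloor>x\<rfloor>}. \<Prod>p\<in>prime_factors r. if p dvd n then 1 - 1 else (1::real))
      = (\<Sum>n\<in>{1..nat \<lfloor>x\<rfloor>}. if coprime n r then 1 else 0)"
    using assms by (intro sum.cong refl) (auto simp: coprime_iff_no_common_prime)
  also have "\<dots> = real (card {n\<in>{1..nat \<lfloor>x\<rfloor>}. coprime n r})"
    by (simp add: sum.inter_filter[symmetric])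
  finally have "(\<Sum>n\<in>{1..nat \<lfloor>x\<rfloor>}. \<Prod>p\<in>prime_factors r. if p dvd n then 1 - 1 else (1::real))
      = real (card {n\<in>{1..nat \<lfloor>x\<rfloor>}. coprime n r})" .
  moreover have "(\<Prod>p\<in>prime_factors r. 1 - 1 / real p) = real (totient r) / real r"
    using assms by (simp add: totient_formula2)
  ultimately show ?thesis
    using sum_sieve_weights[of "prime_factors r" "\<lambda>_. 1" x] assms by auto
qed

text \<open>Every prime except 2 and 3 is at least 4. The factor 3 absorbs these two: 16 \<le> 3 * 6
  when both occur. Base 4 is the square of the 2 in the sieve error, whence the square root in the
  next bound.\<close>

lemma four_power_card_primes_le:
  fixes S :: "nat set"
  assumes "finite S" "\<And>p. p \<in> S \<Longrightarrow> prime p"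
  shows "4 ^ card S \<le> 3 * \<Prod>S"
proof -
  define T where "T = S - {2, 3}"
  have "4 ^ card T = (\<Prod>p\<in>T. 4::nat)" by simp
  also have "\<dots> \<le> \<Prod>T"
  proof (intro prod_mono conjI)
    fix p assume p: "p \<in> T"
    hence "prime p" "p \<noteq> 2" "p \<noteq> 3" using assms by (auto simp: T_def)
    thus "4 \<le> p" using prime_ge_2_nat[of p] by linarith
  qed auto
  finally have T: "4 ^ card T \<le> \<Prod>T" .
  have fin: "finite T" using assms by (simp add: T_def)
  have S: "S = T \<union> (S \<inter> {2, 3})" "T \<inter> (S \<inter> {2, 3}) = {}" by (auto simp: T_def)
  have card: "card S = card T + card (S \<inter> {2, 3})"
    using S fin assms(1) by (metis card_Un_disjoint finite_Int)
  have prod: "\<Prod>S = \<Prod>T * \<Prod>(S \<inter> {2, 3})"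
    using S fin assms(1) by (metis prod.union_disjoint finite_Int)
  have "S \<inter> {2, 3} \<in> {{}, {2}, {3}, {2, 3}}" by auto
  hence "4 ^ card (S \<inter> {2, 3}) \<le> 3 * \<Prod>(S \<inter> {2, 3})" by auto
  with T show ?thesis unfolding card prod power_add
    by (metis (no_types, lifting) mult.left_commute mult_le_mono)
qed

lemma two_power_card_prime_factors_le:
  assumes "q > 0"
  shows "2 ^ card (prime_factors q) \<le> 2 * sqrt (real q)"
proof -
  have "\<Prod>(prime_factors q) dvd q"
  proof -
    have "\<Prod>(prime_factors q) dvd (\<Prod>p\<in>prime_factors q. p ^ multiplicity p q)"
      by (intro prod_dvd_prod) (auto simp: prime_factors_multiplicity)
    thus ?thesis using prime_factorization_nat[of q] assms by simp
  qed
  hence "\<Prod>(prime_factors q) \<le> q" using assms by (rule dvd_imp_le)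
  hence "4 ^ card (prime_factors q) \<le> 3 * q"
    using four_power_card_primes_le[of "prime_factors q"] by fastforce
  hence "real (4 ^ card (prime_factors q)) \<le> real (3 * q)" by (rule of_nat_mono)
  hence "(2 ^ card (prime_factors q))\<^sup>2 \<le> 4 * real q"
    by (simp add: power2_eq_square power_mult_distrib[symmetric])
  also have "\<dots> = (2 * sqrt (real q))\<^sup>2" by (simp add: power_mult_distrib)
  finally show ?thesis by (rule power2_le_imp_le) auto
qed

section \<open>A linear congruence in units\<close>

text \<open>Take v = u + n t with t the product of the primes of q that do not divide u. Each prime
  of q then divides exactly one of u and n t: a prime dividing u divides neither n, which is coprime
  to u, nor t.\<close>

lemma exists_coprime_lift:
  fixes u n q :: nat
  assumes "coprime u n" "n dvd q" "q > 0"
  shows "\<exists>v. coprime v q \<and> [v = u] (mod n)"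
proof -
  define t where "t = \<Prod>{p\<in>prime_factors q. \<not> p dvd u}"
  have "\<not> p dvd u + n * t" if p: "p \<in> prime_factors q" for p
  proof (cases "p dvd u")
    case True
    have prime: "prime p" using p by auto
    have "\<not> p dvd n" using True assms(1) prime
      by (metis coprime_common_divisor not_prime_unit)
    moreover have "\<not> p dvd t"
    proof
      assume "p dvd t"
      then obtain r where "r \<in> prime_factors q" "\<not> r dvd u" "p dvd r"
        unfolding t_def using prime by (auto simp: prime_dvd_prod_iff)
      thus False using True prime by (metis in_prime_factors_iff primes_dvd_imp_eq)
    qed
    ultimately show ?thesis using True prime
      by (metis dvd_add_right_iff prime_dvd_mult_iff)
  next
    case False
    have "p dvd t" unfolding t_def using p False by (intro dvd_prodI) auto
    thus ?thesis using False by (metis dvd_add_left_iff dvd_mult)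
  qed
  hence "coprime (u + n * t) q" using assms by (simp add: coprime_iff_no_common_prime)
  moreover have "[u + n * t = u] (mod n)" by (simp add: cong_def)
  ultimately show ?thesis by blast
qed

text \<open>With h the common gcd, the quotient of s' / h by s / h is a unit modulo q / h; lifting
  it to a unit modulo q gives v.\<close>

lemma exists_unit_multiplier:
  fixes s s' q :: nat
  assumes "gcd s q = gcd s' q" "q > 0"
  shows "\<exists>v. coprime v q \<and> [v * s = s'] (mod q)"
proof -
  define h where "h = gcd s q"
  have h: "h > 0" using assms by (simp add: h_def)
  obtain s1 n where s1: "s = s1 * h" "q = n * h" "coprime s1 n"
    using gcd_coprime_exists[of s q] h unfolding h_def by auto
  obtain s2 n' where s2: "s' = s2 * h" "q = n' * h" "coprime s2 n'"
    using gcd_coprime_exists[of s' q] h assms(1) unfolding h_def by auto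
  have nn: "n' = n" using s1 s2 h by simp
  obtain x where x: "[s1 * x = Suc 0] (mod n)"
    using cong_solve_coprime_nat[OF s1(3)] by auto
  hence "coprime x n" by (metis coprime_iff_invertible_nat mult.commute)
  hence "coprime (s2 * x) n" using s2 nn by simp
  moreover have "n dvd q" using s1 by simp
  ultimately obtain v where v: "coprime v q" "[v = s2 * x] (mod n)"
    using exists_coprime_lift assms(2) by blast
  have "[v * s1 = s2 * x * s1] (mod n)" using v(2) by (rule cong_scalar_right)
  also have "s2 * x * s1 = s2 * (s1 * x)" by simp
  also have "[\<dots> = s2 * Suc 0] (mod n)" using x by (rule cong_scalar_left)
  finally have "[v * s1 = s2] (mod n)" by simp
  hence "[v * s = s'] (mod q)"
    unfolding s1 s2(1) cong_def by (simp add: mult.assoc[symmetric] mod_mult_mult2)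
  with v show ?thesis by blast
qed

text \<open>The numerators a for which a / q is reduced and b = (a s + D) / q is an integer. The
  range is 1..q rather than 0..<q to match the Farey fractions: for q = 1 the numerator is
  1.\<close>

definition unit_sols :: "nat \<Rightarrow> nat \<Rightarrow> nat \<Rightarrow> nat set" where
  "unit_sols q D s = {a\<in>{1..q}. coprime a q \<and> q dvd a * s + D}"

lemma finite_unit_sols [simp]: "finite (unit_sols q D s)"
  by (simp add: unit_sols_def)

text \<open>Numerators run over 1..q, while \<open>mod q\<close> produces values below q; the
  representatives q and 0 are exchanged.\<close>

lemma card_residues_shift:
  assumes "P 0 \<longleftrightarrow> P q"
  shows "card {a\<in>{1..q}. P a} = card {a\<in>{..<q}. P (a::nat)}"
proof (cases "q = 0")
  case False
  show ?thesis
  proof (rule bij_betw_same_card[of "\<lambda>a. if a = q then 0 else a"])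
    show "bij_betw (\<lambda>a. if a = q then 0 else a) {a\<in>{1..q}. P a} {a\<in>{..<q}. P a}"
      using assms False
      by (intro bij_betw_byWitness[where f' = "\<lambda>a. if a = 0 then q else a"]) auto
  qed
qed auto

text \<open>If \<open>v s \<equiv> s'\<close> modulo \<open>q\<close> with \<open>v\<close> a unit, then \<open>a \<mapsto> a v\<close> carries solutions for \<open>s'\<close> to solutions
  for \<open>s\<close>; hence the number of solutions depends only on \<open>gcd s q\<close>.\<close>

lemma card_unit_sols_le:
  assumes "gcd s q = gcd s' q" "q > 0"
  shows "card (unit_sols q D s') \<le> card (unit_sols q D s)"
proof -
  obtain v where v: "coprime v q" "[v * s = s'] (mod q)"
    using exists_unit_multiplier[OF assms] by blast
  define B where "B = (\<lambda>s. {a\<in>{..<q}. coprime a q \<and> q dvd a * s + D})"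
  have shift: "card (unit_sols q D s) = card (B s)" for s
    unfolding unit_sols_def B_def
    by (rule card_residues_shift) (auto simp: dvd_add_right_iff)
  have "card (B s') \<le> card (B s)"
  proof (rule card_inj_on_le[of "\<lambda>a. a * v mod q"])
    show "inj_on (\<lambda>a. a * v mod q) (B s')"
    proof (rule inj_onI)
      fix a b assume ab: "a \<in> B s'" "b \<in> B s'" "a * v mod q = b * v mod q"
      hence "[a * v = b * v] (mod q)" by (simp add: cong_def)
      hence "[a = b] (mod q)" using v(1) by (simp add: cong_mult_rcancel_nat)
      thus "a = b" using ab by (auto simp: B_def cong_def)
    qed
    show "(\<lambda>a. a * v mod q) ` B s' \<subseteq> B s"
    proof safe
      fix a assume a: "a \<in> B s'"
      have "[a * v mod q * s + D = a * v * s + D] (mod q)"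
        by (intro cong_add cong_mult cong_mod_leftI) auto
      also have "a * v * s + D = a * (v * s) + D" by simp
      also have "[\<dots> = a * s' + D] (mod q)" using v by (intro cong_add cong_mult) auto
      finally have "q dvd a * v mod q * s + D" using a by (simp add: B_def cong_dvd_iff)
      moreover have "coprime (a * v mod q) q" using a v by (simp add: B_def)
      ultimately show "a * v mod q \<in> B s" using assms by (auto simp: B_def)
    qed
  qed (auto simp: B_def)
  thus ?thesis by (simp add: shift)
qed

text \<open>As a is a unit modulo q, gcd s q = gcd (a s) q, and a s is congruent to -D.\<close>

lemma unit_sols_gcd:
  assumes "a \<in> unit_sols q D s"
  shows "gcd s q = gcd D q"
proof -
  have a: "coprime a q" "q dvd a * s + D" using assms by (auto simp: unit_sols_def)
  have "gcd s q = gcd (a * s) q" using a(1) by (simp add: gcd_mult_left_left_cancel coprime_commute)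
  also have "\<dots> = gcd D q"
  proof (rule dvd_antisym)
    show "gcd (a * s) q dvd gcd D q"
      using a(2) by (meson dvd_add_right_iff dvd_trans gcd_dvd1 gcd_dvd2 gcd_greatest)
    show "gcd D q dvd gcd (a * s) q"
      using a(2) by (meson dvd_add_left_iff dvd_trans gcd_dvd1 gcd_dvd2 gcd_greatest)
  qed
  finally show ?thesis .
qed

lemma unit_sols_empty: "gcd s q \<noteq> gcd D q \<Longrightarrow> unit_sols q D s = {}"
  using unit_sols_gcd by blast

text \<open>Double counting: for each unit a, exactly one s in a complete residue system satisfies
  the congruence.\<close>

lemma sum_card_unit_sols:
  assumes "q > 0"
  shows "(\<Sum>s\<in>{0<..q}. card (unit_sols q D s)) = totient q"
proof -
  have one: "card {s\<in>{1..q}. q dvd a * s + D} = 1" if a: "coprime a q" for a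
  proof -
    have "card {s\<in>{1..q}. q dvd a * s + D} = card {s\<in>{..<q}. q dvd a * s + D}"
      by (rule card_residues_shift) (auto simp: dvd_add_right_iff)
    also have "\<dots> = 1"
    proof -
      obtain x where x: "[a * x = Suc 0] (mod q)" using cong_solve_coprime_nat[OF a] by auto
      \<comment> \<open>The factor q - 1 stands for -1 in the natural numbers, and x inverts
        a.\<close>
      define s where "s = x * ((q - 1) * D) mod q"
      have "[a * s + D = a * (x * ((q - 1) * D)) + D] (mod q)"
        unfolding s_def by (intro cong_add cong_mult cong_mod_leftI) auto
      also have "a * (x * ((q - 1) * D)) + D = a * x * ((q - 1) * D) + D" by simp
      also have "[\<dots> = Suc 0 * ((q - 1) * D) + D] (mod q)"
        using x by (intro cong_add cong_mult) auto
      also have "Suc 0 * ((q - 1) * D) + D = q * D"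
        using assms by (cases q) auto
      finally have s: "q dvd a * s + D" by (simp add: cong_dvd_iff)
      have "{s\<in>{..<q}. q dvd a * s + D} = {s}"
      proof (intro equalityI subsetI)
        fix t assume t: "t \<in> {s\<in>{..<q}. q dvd a * s + D}"
        hence "[a * t + D = a * s + D] (mod q)" using s
          by (simp add: cong_def mod_eq_0_iff_dvd[symmetric])
        hence "[t = s] (mod q)"
          using a by (simp add: cong_add_rcancel_nat cong_mult_lcancel_nat)
        thus "t \<in> {s}" using t assms by (auto simp: cong_def s_def)
      qed (use s assms in \<open>auto simp: s_def\<close>)
      thus ?thesis by simp
    qed
    finally show ?thesis .
  qed
  have "(\<Sum>s\<in>{0<..q}. card (unit_sols q D s))
      = (\<Sum>s\<in>{0<..q}. \<Sum>a\<in>totatives q. if q dvd a * s + D then 1 else 0)"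
  proof (intro sum.cong refl)
    fix s
    have "unit_sols q D s = {a\<in>totatives q. q dvd a * s + D}"
      by (auto simp: unit_sols_def totatives_def)
    thus "card (unit_sols q D s) = (\<Sum>a\<in>totatives q. if q dvd a * s + D then 1 else 0)"
      by (simp add: sum.inter_filter[symmetric])
  qed
  also have "\<dots> = (\<Sum>a\<in>totatives q. \<Sum>s\<in>{0<..q}. if q dvd a * s + D then 1 else 0)"
    by (rule sum.swap)
  also have "\<dots> = (\<Sum>a\<in>totatives q. 1)"
  proof (intro sum.cong refl)
    fix a assume "a \<in> totatives q"
    hence "card {s\<in>{1..q}. q dvd a * s + D} = 1" by (intro one) (auto simp: totatives_def)
    moreover have "{0<..q} = {1..q}" by auto
    ultimately show "(\<Sum>s\<in>{0<..q}. if q dvd a * s + D then 1 else 0) = (1::nat)"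
      by (simp only: sum.inter_filter[symmetric] finite_atLeastAtMost card_eq_sum)
  qed
  finally show ?thesis by (simp add: totient_def)
qed

text \<open>Of the \<open>totient q\<close> solutions in all, each s with gcd s q = gcd D q receives
  the same number and every other s none; there are \<open>totient (q div gcd D q)\<close> such s up
  to q.\<close>

lemma card_unit_sols:
  assumes "q > 0" "gcd s q = gcd D q"
  shows "card (unit_sols q D s) * totient (q div gcd D q) = totient q"
proof -
  define h where "h = gcd D q"
  have "totient q = (\<Sum>s'\<in>{0<..q}. card (unit_sols q D s'))"
    using sum_card_unit_sols[OF assms(1)] by simp
  also have "\<dots> = (\<Sum>s'\<in>{s'\<in>{0<..q}. gcd s' q = h}. card (unit_sols q D s'))"
  proof (rule sum.mono_neutral_right)
    show "\<forall>i\<in>{0<..q} - {s' \<in> {0<..q}. gcd s' q = h}. card (unit_sols q D i) = 0"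
      using unit_sols_empty[of _ q D] unfolding h_def by force
  qed auto
  also have "\<dots> = (\<Sum>s'\<in>{s'\<in>{0<..q}. gcd s' q = h}. card (unit_sols q D s))"
  proof (intro sum.cong refl)
    fix s' assume "s' \<in> {s'\<in>{0<..q}. gcd s' q = h}"
    hence "gcd s' q = gcd s q" using assms by (simp add: h_def)
    thus "card (unit_sols q D s') = card (unit_sols q D s)"
      using card_unit_sols_le[of s q s' D] card_unit_sols_le[of s' q s D] assms by auto
  qed
  also have "\<dots> = card (unit_sols q D s) * totient (q div h)"
    using card_gcd_eq_totient[of q h] assms by (simp add: h_def)
  finally show ?thesis by (simp add: h_def)
qed

lemma totient_mult_le: "totient (h * n) \<le> h * totient n"
proof (cases "h = 0 \<or> n = 0")
  case False
  let ?f = "\<lambda>p. 1 - 1 / real p"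
  have f: "0 \<le> ?f p" "?f p \<le> 1" if "p \<in> prime_factors k" for p k
    using prime_gt_0_nat[OF in_prime_factors_imp_prime[OF that]] by auto
  have sub: "prime_factors n \<subseteq> prime_factors (h * n)"
    using False by (auto simp: prime_factors_product)
  have "real (totient (h * n)) = real (h * n) * (\<Prod>p\<in>prime_factors (h * n). ?f p)"
    by (rule totient_formula2)
  also have "(\<Prod>p\<in>prime_factors (h * n). ?f p)
      = (\<Prod>p\<in>prime_factors (h * n) - prime_factors n. ?f p) * (\<Prod>p\<in>prime_factors n. ?f p)"
    using sub by (intro prod.subset_diff) auto
  also have "\<dots> \<le> 1 * (\<Prod>p\<in>prime_factors n. ?f p)"
    using f by (intro mult_right_mono prod_le_1 prod_nonneg) auto
  finally have "real (totient (h * n)) \<le> real (h * n) * (\<Prod>p\<in>prime_factors n. ?f p)"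
    by (simp add: mult_left_mono)
  also have "\<dots> = real (h * totient n)" by (simp add: totient_formula2)
  finally show ?thesis by linarith
qed auto

text \<open>The main term does not depend on \<open>D\<close>: the factor \<open>totient q / totient (q div gcd D q)\<close> of solutions per \<open>s\<close>
  cancels against the density of the \<open>s\<close> with \<open>gcd s q = gcd D q\<close>.\<close>

lemma sum_card_unit_sols_coprime:
  fixes y :: real
  assumes "q > 0" "D > 0" "m > 0" "coprime q m" "y \<ge> 0"
  shows "\<bar>(\<Sum>s\<in>{s\<in>{1..nat \<lfloor>y\<rfloor>}. coprime s m}. real (card (unit_sols q D s))) -
            y * (real (totient m) / real m) * (real (totient q) / real q)\<bar>
         \<le> real D * 2 ^ card (prime_factors m) * 2 ^ card (prime_factors q)"
proof -
  define h where "h = gcd D q"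
  define n where "n = q div h"
  define \<nu> where "\<nu> = real (totient q) / real (totient n)"
  have h: "h > 0" "h dvd q" "h \<le> D" using assms by (auto simp: h_def intro: dvd_imp_le)
  have q: "q = h * n" using h by (simp add: n_def)
  have n: "n > 0" using q assms by (auto intro: Nat.gr0I)
  have hm: "coprime h m" "coprime n m" using assms q by auto
  have tn: "real (totient n) > 0" using n by simp
  have \<nu>: "real (card (unit_sols q D s)) = \<nu>" if "gcd s q = h" for s
  proof -
    have "card (unit_sols q D s) * totient n = totient q"
      using card_unit_sols[of q s D] assms that by (simp add: h_def n_def)
    thus ?thesis using tn by (simp add: \<nu>_def field_simps flip: of_nat_mult)
  qed
  \<comment> \<open>The chain \<nu> \<le> h \<le> D bounds the factor in front of the sieve error by
    D, uniformly in q.\<close>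
  have "totient q \<le> h * totient n" unfolding q by (rule totient_mult_le)
  hence "real (totient q) \<le> real h * real (totient n)" by (simp flip: of_nat_mult)
  hence \<nu>h: "\<nu> \<le> h" "\<nu> \<ge> 0" using tn by (auto simp: \<nu>_def field_simps)
  define A where "A = {s\<in>{1..nat \<lfloor>y\<rfloor>}. coprime s m \<and> gcd s q = h}"
  have "(\<Sum>s\<in>{s\<in>{1..nat \<lfloor>y\<rfloor>}. coprime s m}. real (card (unit_sols q D s)))
      = (\<Sum>s\<in>A. real (card (unit_sols q D s)))"
  proof (rule sum.mono_neutral_right)
    show "\<forall>i\<in>{s \<in> {1..nat \<lfloor>y\<rfloor>}. coprime s m} - A. real (card (unit_sols q D i)) = 0"
      by (auto simp: h_def A_def unit_sols_empty)
  qed (auto simp: A_def)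
  also have "\<dots> = (\<Sum>s\<in>A. \<nu>)" by (intro sum.cong refl \<nu>) (auto simp: A_def)
  also have "\<dots> = \<nu> * real (card A)" by simp
  also have "real (card A) = (\<Sum>s\<in>{s\<in>{1..nat \<lfloor>y\<rfloor>}. h dvd s}. if coprime s m \<and> gcd s q = h then 1 else 0)"
  proof -
    have "A = {s\<in>{s\<in>{1..nat \<lfloor>y\<rfloor>}. h dvd s}. coprime s m \<and> gcd s q = h}"
      unfolding A_def by auto
    thus ?thesis by (simp add: sum.inter_filter[symmetric])
  qed
  \<comment> \<open>For s = h k the condition gcd s q = h becomes coprimality of k and n, which
    merges with coprimality to m into one sieve by m n.\<close>
  also have "\<dots> = (\<Sum>k\<in>{1..nat \<lfloor>y / real h\<rfloor>}. if coprime (h * k) m \<and> gcd (h * k) q = h then 1 else 0)"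
    using h assms by (intro sum_multiples_upto) auto
  also have "\<dots> = (\<Sum>k\<in>{1..nat \<lfloor>y / real h\<rfloor>}. if coprime k (m * n) then 1 else 0)"
  proof (intro sum.cong refl)
    fix k
    have "gcd (h * k) q = h * gcd k n" by (simp add: q gcd_mult_distrib_nat)
    thus "(if coprime (h * k) m \<and> gcd (h * k) q = h then 1 else 0) = (if coprime k (m * n) then 1 else (0::real))"
      using h hm by (auto simp flip: coprime_iff_gcd_eq_1) (simp add: coprime_iff_gcd_eq_1)
  qed
  also have "\<dots> = real (card {k\<in>{1..nat \<lfloor>y / real h\<rfloor>}. coprime k (m * n)})"
    by (simp add: sum.inter_filter[symmetric])
  finally have sum_eq: "(\<Sum>s\<in>{s\<in>{1..nat \<lfloor>y\<rfloor>}. coprime s m}. real (card (unit_sols q D s)))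
     = \<nu> * real (card {k\<in>{1..nat \<lfloor>y / real h\<rfloor>}. coprime k (m * n)})" .
  have "totient (m * n) = totient m * totient n"
    using hm by (intro totient_mult_coprime) (simp add: coprime_commute)
  hence main: "y * (real (totient m) / real m) * (real (totient q) / real q)
      = \<nu> * (y / real h * (real (totient (m * n)) / real (m * n)))"
    using tn h n by (simp add: \<nu>_def q field_simps)
  have "\<bar>(\<Sum>s\<in>{s\<in>{1..nat \<lfloor>y\<rfloor>}. coprime s m}. real (card (unit_sols q D s))) -
            y * (real (totient m) / real m) * (real (totient q) / real q)\<bar>
      = \<nu> * \<bar>real (card {k\<in>{1..nat \<lfloor>y / real h\<rfloor>}. coprime k (m * n)})
            - y / real h * (real (totient (m * n)) / real (m * n))\<bar>"
    unfolding sum_eq main right_diff_distrib[symmetric] using \<nu>h by (simp add: abs_mult)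
  also have "\<dots> \<le> real D * 2 ^ card (prime_factors (m * n))"
    using \<nu>h h assms n by (intro mult_mono card_coprime_upto) auto
  also have "\<dots> \<le> real D * 2 ^ (card (prime_factors m) + card (prime_factors q))"
  proof (intro mult_left_mono power_increasing)
    have "prime_factors (m * n) \<subseteq> prime_factors m \<union> prime_factors q"
      using assms n h by (auto simp: q prime_factors_product)
    hence "card (prime_factors (m * n)) \<le> card (prime_factors m \<union> prime_factors q)"
      by (intro card_mono) auto
    also have "\<dots> \<le> card (prime_factors m) + card (prime_factors q)" by (rule card_Un_le)
    finally show "card (prime_factors (m * n)) \<le> card (prime_factors m) + card (prime_factors q)" .
  qed auto
  finally show ?thesis by (simp add: power_add mult.assoc)
qed

section \<open>The mean value of the totient ratio\<close>

lemma sum_inverse_squares_tail: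
  assumes "P \<ge> 1"
  shows "(\<Sum>k\<in>{P<..n}. 1 / (real k)\<^sup>2) \<le> 1 / real P"
proof -
  have "(\<Sum>k\<in>{P<..n}. 1 / (real k)\<^sup>2) \<le> 1 / real P - 1 / real n" if "n \<ge> P"
    using that
  proof (induction n rule: dec_induct)
    case (step n)
    have n: "real n > 0" using step assms by simp
    have "{P<..Suc n} = insert (Suc n) {P<..n}" using step by auto
    hence "(\<Sum>k\<in>{P<..Suc n}. 1 / (real k)\<^sup>2) \<le> 1 / real P - 1 / real n + 1 / (real (Suc n))\<^sup>2"
      using step by simp
    also have "1 / (real (Suc n))\<^sup>2 \<le> 1 / (real n * real (Suc n))"
      using n by (intro divide_left_mono) (auto simp: power2_eq_square)
    also have "1 / (real n * real (Suc n)) = 1 / real n - 1 / real (Suc n)"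
      using n by (simp add: field_simps)
    finally show ?case by simp
  qed simp
  thus ?thesis by (cases "n \<ge> P") (auto intro: order_trans)
qed

section \<open>The Euler product of zeta(2)\<close>

definition free_of :: "nat set \<Rightarrow> nat set" where
  "free_of S = {n. n > 0 \<and> (\<forall>p\<in>S. \<not> p dvd n)}"

lemma inverse_squares_summable_on: "(\<lambda>n. 1 / (real n)\<^sup>2) summable_on A"
proof (rule summable_on_subset_banach)
  show "(\<lambda>n. 1 / (real n)\<^sup>2) summable_on UNIV"
    using inverse_power_summable[of 2, where 'a = real]
    by (intro summable_nonneg_imp_summable_on) (auto simp: inverse_eq_divide)
qed auto

text \<open>Since p is not in S, the multiples of p in \<open>free_of S\<close> are p times the
  elements of \<open>free_of S\<close>; removing them multiplies the sum by 1 - 1 / p^2.\<close>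

lemma infsum_free_of:
  assumes "finite S" "\<And>p. p \<in> S \<Longrightarrow> prime p"
  shows "infsum (\<lambda>n. 1 / (real n)\<^sup>2) (free_of S)
       = (\<Prod>p\<in>S. 1 - 1 / (real p)\<^sup>2) * infsum (\<lambda>n. 1 / (real n)\<^sup>2) (free_of {})"
  using assms
proof (induction S rule: finite_induct)
  case (insert p S)
  let ?f = "\<lambda>n. 1 / (real n)\<^sup>2"
  have p: "prime p" "p > 0" using insert.prems prime_gt_0_nat[of p] by auto
  have iff: "r dvd p * n \<longleftrightarrow> r dvd n" if "r \<in> S" for r n
    using that insert p by (metis insertCI prime_dvd_mult_iff primes_dvd_imp_eq)
  have "free_of S = free_of (insert p S) \<union> (\<lambda>n. p * n) ` free_of S"
  proof (intro equalityI subsetI)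
    fix n assume n: "n \<in> free_of S"
    show "n \<in> free_of (insert p S) \<union> (\<lambda>n. p * n) ` free_of S"
    proof (cases "p dvd n")
      case True
      then obtain k where k: "n = p * k" by auto
      have "k \<in> free_of S" using n iff[of _ k] p by (auto simp: free_of_def k)
      thus ?thesis using k by blast
    qed (use n in \<open>auto simp: free_of_def\<close>)
  qed (use iff p in \<open>auto simp: free_of_def\<close>)
  hence "infsum ?f (free_of S) = infsum ?f (free_of (insert p S) \<union> (\<lambda>n. p * n) ` free_of S)"
    by simp
  also have "\<dots> = infsum ?f (free_of (insert p S)) + infsum ?f ((\<lambda>n. p * n) ` free_of S)"
    by (intro infsum_Un_disjoint inverse_squares_summable_on) (auto simp: free_of_def)
  also have "infsum ?f ((\<lambda>n. p * n) ` free_of S) = infsum (\<lambda>n. 1 / (real p)\<^sup>2 * ?f n) (free_of S)"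
    using p by (subst infsum_reindex) (auto simp: inj_on_def o_def power_mult_distrib)
  also have "\<dots> = 1 / (real p)\<^sup>2 * infsum ?f (free_of S)"
    by (rule infsum_cmult_right')
  finally have "infsum ?f (free_of (insert p S)) = (1 - 1 / (real p)\<^sup>2) * infsum ?f (free_of S)"
    by (simp add: algebra_simps)
  thus ?case using insert by (simp add: mult.assoc)
qed simp

lemma zeta_2_eq_infsum: "zeta 2 = infsum (\<lambda>n. 1 / (real n)\<^sup>2) (free_of {})"
proof -
  let ?f = "\<lambda>n. 1 / (real n)\<^sup>2"
  have "free_of {} = range Suc" by (auto simp: free_of_def image_iff) (metis Suc_pred)
  hence "infsum ?f (free_of {}) = infsum (?f \<circ> Suc) UNIV"
    by (simp add: infsum_reindex)
  moreover have "(?f \<circ> Suc) summable_on UNIV"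
    by (subst summable_on_reindex[symmetric]) (auto intro: inverse_squares_summable_on)
  hence "((?f \<circ> Suc) has_sum infsum (?f \<circ> Suc) UNIV) UNIV" by (rule has_sum_infsum)
  hence "(?f \<circ> Suc) sums infsum (?f \<circ> Suc) UNIV" by (rule has_sum_imp_sums)
  ultimately have "suminf (?f \<circ> Suc) = infsum ?f (free_of {})" by (simp add: sums_iff)
  moreover have "zeta 2 = suminf (?f \<circ> Suc)"
    unfolding zeta_def by (simp add: o_def powr_numeral)
  ultimately show ?thesis by simp
qed

text \<open>Besides 1, every element has a prime factor above P and so exceeds P itself; hence 1
  contributes the main term and the rest at most 1 / P.\<close>

lemma infsum_free_of_primes_bounds:
  assumes "P \<ge> 1"
  shows "infsum (\<lambda>n. 1 / (real n)\<^sup>2) (free_of {p. prime p \<and> p \<le> P}) \<in> {1..1 + 1 / real P}"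
proof -
  let ?f = "\<lambda>n. 1 / (real n)\<^sup>2" and ?A = "free_of {p. prime p \<and> p \<le> P}"
  have one: "1 \<in> ?A" by (auto simp: free_of_def dest: prime_gt_1_nat)
  have large: "n > P" if n: "n \<in> ?A" "n \<noteq> 1" for n
  proof -
    obtain p where p: "prime p" "p dvd n" using n(2) prime_factor_nat by blast
    hence "\<not> p \<le> P" using n(1) by (auto simp: free_of_def)
    hence "p > P" by simp
    moreover have "p \<le> n" using p n by (intro dvd_imp_le) (auto simp: free_of_def)
    ultimately show ?thesis by simp
  qed
  have "infsum ?f {1} \<le> infsum ?f ?A"
    using one by (intro infsum_mono2 inverse_squares_summable_on) auto
  moreover have "infsum ?f ?A \<le> 1 + 1 / real P"
  proof (rule infsum_le_finite_sums[OF inverse_squares_summable_on])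
    fix F assume F: "finite F" "F \<subseteq> ?A"
    have "sum ?f F \<le> sum ?f (insert 1 {P<..Max (insert 0 F)})"
    proof (intro sum_mono2)
      show "F \<subseteq> insert 1 {P<..Max (insert 0 F)}"
        using F(2) large Max_ge[of "insert 0 F"] F(1) by (auto simp: subset_iff)
    qed auto
    also have "\<dots> = 1 + sum ?f {P<..Max (insert 0 F)}" using assms by simp
    also have "\<dots> \<le> 1 + 1 / real P" using sum_inverse_squares_tail[OF assms] by simp
    finally show "sum ?f F \<le> 1 + 1 / real P" .
  qed
  ultimately show ?thesis by simp
qed

lemma zeta_2_ge_1: "zeta 2 \<ge> 1"
proof -
  have "infsum (\<lambda>n. 1 / (real n)\<^sup>2) {1} \<le> zeta 2"
    unfolding zeta_2_eq_infsum
    by (intro infsum_mono2 inverse_squares_summable_on) (auto simp: free_of_def)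
  thus ?thesis by simp
qed

lemma euler_product_zeta_2:
  "(\<lambda>P. \<Prod>p | prime p \<and> p \<le> P. 1 - 1 / (real p)\<^sup>2) \<longlonglongrightarrow> 1 / zeta 2"
proof -
  let ?E = "\<lambda>P. \<Prod>p | prime p \<and> p \<le> P. 1 - 1 / (real p)\<^sup>2"
  have "(\<lambda>P. ?E P * zeta 2) \<longlonglongrightarrow> 1"
  proof (rule tendsto_sandwich)
    have *: "?E P * zeta 2 \<in> {1..1 + 1 / real P}" if "P \<ge> 1" for P
      using infsum_free_of_primes_bounds[OF that]
      by (subst (asm) infsum_free_of) (auto simp: zeta_2_eq_infsum)
    show "\<forall>\<^sub>F P in sequentially. 1 \<le> ?E P * zeta 2"
      using eventually_ge_at_top[of 1] by eventually_elim (use * in auto)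
    show "\<forall>\<^sub>F P in sequentially. ?E P * zeta 2 \<le> 1 + 1 / real P"
      using eventually_ge_at_top[of 1] by eventually_elim (use * in auto)
    have "(\<lambda>P. 1 + 1 / real P) \<longlonglongrightarrow> 1 + 0" by (intro tendsto_intros lim_1_over_n)
    thus "(\<lambda>P. 1 + 1 / real P) \<longlonglongrightarrow> 1" by simp
  qed auto
  from tendsto_mult_right[OF this, of "1 / zeta 2"] show ?thesis using zeta_2_ge_1 by simp
qed

lemma prime_inverse_square_less_1:
  assumes "prime p"
  shows "1 / (real p)\<^sup>2 < 1"
  using prime_gt_1_nat[OF assms] by simp

definition euler_factor :: "nat \<Rightarrow> nat \<Rightarrow> real" where
  "euler_factor m p = (if prime p \<and> \<not> p dvd m then 1 - 1 / (real p)\<^sup>2 else 1)"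

lemma convergent_prod_euler_factor: "convergent_prod (euler_factor m)"
proof -
  have "summable (\<lambda>n. 1 / (real n)\<^sup>2)"
    using inverse_power_summable[of 2, where 'a = real] by (simp add: inverse_eq_divide)
  hence "summable (\<lambda>n. norm (euler_factor m n - 1))"
    by (rule summable_comparison_test') (auto simp: euler_factor_def)
  thus ?thesis
    by (intro abs_convergent_prod_imp_convergent_prod) (simp add: abs_convergent_prod_conv_summable)
qed

text \<open>For P \<ge> m all primes dividing m are at most P, so multiplying the partial product by
  their finitely many factors completes it to a partial product for 1 / zeta(2).\<close>

lemma C_eq_prodinf:
  assumes "m > 0"
  shows "C m = real (totient m) / real m * prodinf (euler_factor m)"
proof -
  define D where "D = (\<Prod>p | prime p \<and> p dvd m. 1 - 1 / (real p)\<^sup>2)"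
  have fin: "finite {p. prime p \<and> p dvd m}" using assms by simp
  have "D > 0"
    unfolding D_def by (intro prod_pos) (auto simp: prime_inverse_square_less_1)
  hence "D \<noteq> 0" by simp
  have eq: "(\<Prod>i\<le>P. euler_factor m i) * D = (\<Prod>p | prime p \<and> p \<le> P. 1 - 1 / (real p)\<^sup>2)"
    if "P \<ge> m" for P
  proof -
    have "(\<Prod>i\<le>P. euler_factor m i) = (\<Prod>p | p \<le> P \<and> prime p \<and> \<not> p dvd m. 1 - 1 / (real p)\<^sup>2)"
      unfolding euler_factor_def
      by (subst prod.inter_filter[symmetric]) (auto intro!: prod.cong)
    moreover have "{p. prime p \<and> p \<le> P} = {p. p \<le> P \<and> prime p \<and> \<not> p dvd m} \<union> {p. prime p \<and> p dvd m}"
      using that assms by (auto dest!: dvd_imp_le)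
    ultimately show ?thesis
      unfolding D_def using fin by (simp only:) (subst prod.union_disjoint[symmetric], auto)
  qed
  have "(\<lambda>P. (\<Prod>i\<le>P. euler_factor m i) * D) \<longlonglongrightarrow> prodinf (euler_factor m) * D"
    by (intro tendsto_mult_right convergent_prod_LIMSEQ convergent_prod_euler_factor)
  moreover have "(\<lambda>P. (\<Prod>i\<le>P. euler_factor m i) * D) \<longlonglongrightarrow> 1 / zeta 2"
  proof (rule Lim_transform_eventually[OF euler_product_zeta_2])
    show "\<forall>\<^sub>F P in sequentially. (\<Prod>p | prime p \<and> p \<le> P. 1 - 1 / (real p)\<^sup>2)
        = (\<Prod>i\<le>P. euler_factor m i) * D"
      using eventually_ge_at_top[of m] by eventually_elim (simp add: eq)
  qed
  ultimately have "prodinf (euler_factor m) * D = 1 / zeta 2" by (rule LIMSEQ_unique)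
  hence "prodinf (euler_factor m) = 1 / (zeta 2 * D)"
    using \<open>D \<noteq> 0\<close> zeta_2_ge_1 by (auto simp: field_simps)
  moreover have "(\<Prod>p | prime p \<and> p dvd m. inverse (1 - 1 / (real p)\<^sup>2)) = 1 / D"
    by (simp add: D_def inverse_eq_divide prod_dividef)
  ultimately show ?thesis unfolding C_def by simp
qed

lemma C_pos:
  assumes "m > 0"
  shows "C m > 0"
  unfolding C_def using assms zeta_2_ge_1
  by (intro mult_pos_pos divide_pos_pos prod_pos)
     (auto simp: prime_inverse_square_less_1)

section \<open>The mean of totient q / q over q coprime to m\<close>

definition dens :: "nat \<Rightarrow> nat \<Rightarrow> real" where
  "dens m q = (if coprime q m then real (totient q) / real q else 0)"

lemma dens_bounds: "0 \<le> dens m q" "dens m q \<le> 1"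
  by (auto simp: dens_def divide_le_eq_1 totient_le)

text \<open>If a prime divides both q and m, W has a factor 0, in agreement with
  \<open>dens m q\<close>. Otherwise W is \<open>dens m q\<close> without the factors 1 - 1 / p at
  the primes p > P of q, and the product of these is at least 1 minus the sum of the 1 / p.\<close>

lemma dens_approx:
  fixes P m q :: nat
  defines "S \<equiv> {p. prime p \<and> p \<le> P} \<union> prime_factors m"
  defines "W \<equiv> (\<Prod>p\<in>S. if p dvd q then 1 - (if p dvd m then 1 else 1 / real p) else 1)"
  assumes "m > 0" "q > 0"
  shows "\<bar>W - dens m q\<bar> \<le> (\<Sum>p | p \<in> prime_factors q \<and> p > P. 1 / real p)"
proof (cases "coprime q m")
  case False
  then obtain p where "p \<in> prime_factors m" "p dvd q"
    using assms coprime_iff_no_common_prime by blast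
  hence "W = 0" unfolding W_def S_def using assms(3)
    by (intro prod_zero bexI[of _ p]) auto
  thus ?thesis using False by (auto simp: dens_def intro!: sum_nonneg)
next
  case True
  let ?f = "\<lambda>p. 1 - 1 / real p"
  have f: "?f p \<in> {0..1}" "1 / real p \<in> {0..1}" if "p \<in> prime_factors q" for p
    using prime_gt_0_nat[OF in_prime_factors_imp_prime[OF that]] by auto
  have nm: "\<not> p dvd m" if "p \<in> prime_factors q" for p
    using that True by (metis coprime_common_divisor in_prime_factors_iff not_prime_unit)
  define A B where "A = {p. p \<in> prime_factors q \<and> p \<le> P}" and "B = {p. p \<in> prime_factors q \<and> p > P}"
  have fin: "finite A" "finite B" unfolding A_def B_def by auto
  have "W = (\<Prod>p\<in>A. ?f p)"
    unfolding W_def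
  proof (rule prod.mono_neutral_cong_right)
    show "finite S" by (auto simp: S_def)
    show "A \<subseteq> S" by (auto simp: A_def S_def)
    show "\<forall>i\<in>S - A. (if i dvd q then 1 - (if i dvd m then 1 else 1 / real i) else 1) = 1"
      using nm assms by (auto simp: A_def S_def in_prime_factors_iff)
    show "\<And>x. x \<in> A \<Longrightarrow> (if x dvd q then 1 - (if x dvd m then 1 else 1 / real x) else 1) = ?f x"
      using nm by (auto simp: A_def)
  qed
  moreover have "dens m q = (\<Prod>p\<in>A. ?f p) * (\<Prod>p\<in>B. ?f p)"
  proof -
    have "prime_factors q = A \<union> B" "A \<inter> B = {}" by (auto simp: A_def B_def)
    hence "(\<Prod>p\<in>prime_factors q. ?f p) = (\<Prod>p\<in>A. ?f p) * (\<Prod>p\<in>B. ?f p)"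
      using fin by (simp add: prod.union_disjoint)
    thus ?thesis using True assms by (simp add: dens_def totient_formula2)
  qed
  ultimately have "W - dens m q = (\<Prod>p\<in>A. ?f p) * (1 - (\<Prod>p\<in>B. ?f p))"
    by (simp add: algebra_simps)
  moreover have "0 \<le> (\<Prod>p\<in>A. ?f p)" "(\<Prod>p\<in>A. ?f p) \<le> 1" "(\<Prod>p\<in>B. ?f p) \<le> 1"
    using f by (auto intro!: prod_nonneg prod_le_1 simp: A_def B_def)
  moreover have "1 - (\<Sum>p\<in>B. 1 / real p) \<le> (\<Prod>p\<in>B. ?f p)"
    using f by (intro Weierstrass_prod_ineq) (auto simp: B_def)
  ultimately have "\<bar>W - dens m q\<bar> \<le> 1 * (\<Sum>p\<in>B. 1 / real p)"
    by (simp only: abs_mult) (intro mult_mono, linarith+)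
  thus ?thesis by (simp add: B_def)
qed

text \<open>Truncating the primes at \<open>P\<close> makes \<open>dens m\<close> a sieve weight with an explicit mean, at the cost of a
  mean error of at most \<open>1 / P\<close>.\<close>

lemma sum_dens_approx:
  assumes "m > 0" "P \<ge> 1"
  shows "\<bar>(\<Sum>q\<in>{1..n}. dens m q) - real n * (real (totient m) / real m * (\<Prod>p\<le>P. euler_factor m p))\<bar>
       \<le> 2 ^ card ({p. prime p \<and> p \<le> P} \<union> prime_factors m) + real n / real P"
proof -
  define S where "S = {p. prime p \<and> p \<le> P} \<union> prime_factors m"
  define c where "c = (\<lambda>p. if p dvd m then 1 else 1 / real p)"
  define W where "W = (\<lambda>q. \<Prod>p\<in>S. if p dvd q then 1 - c p else 1)"
  have finS: "finite S" by (simp add: S_def)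
  have cp: "0 \<le> c p \<and> c p \<le> 1" for p by (auto simp: c_def divide_le_eq)
  have main: "(\<Prod>p\<in>S. 1 - c p / real p) = real (totient m) / real m * (\<Prod>p\<le>P. euler_factor m p)"
  proof -
    have "S = prime_factors m \<union> {p. p \<le> P \<and> prime p \<and> \<not> p dvd m}"
      using assms by (auto simp: S_def in_prime_factors_iff)
    hence "(\<Prod>p\<in>S. 1 - c p / real p) = (\<Prod>p\<in>prime_factors m. 1 - c p / real p)
              * (\<Prod>p | p \<le> P \<and> prime p \<and> \<not> p dvd m. 1 - c p / real p)"
      by (subst prod.union_disjoint[symmetric]) auto
    also have "(\<Prod>p\<in>prime_factors m. 1 - c p / real p) = (\<Prod>p\<in>prime_factors m. 1 - 1 / real p)"
      by (intro prod.cong) (auto simp: c_def)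
    also have "\<dots> = real (totient m) / real m" using assms by (simp add: totient_formula2)
    also have "(\<Prod>p | p \<le> P \<and> prime p \<and> \<not> p dvd m. 1 - c p / real p) = (\<Prod>p\<le>P. euler_factor m p)"
      unfolding euler_factor_def
      by (subst prod.inter_filter[symmetric]) (auto intro!: prod.cong simp: c_def power2_eq_square)
    finally show ?thesis .
  qed
  have "\<bar>(\<Sum>q\<in>{1..n}. W q) - real n * (\<Prod>p\<in>S. 1 - c p / real p)\<bar> \<le> 2 ^ card S"
  proof -
    have "prime p" if "p \<in> S" for p using that by (auto simp: S_def)
    thus ?thesis
      using sum_sieve_weights[OF finS, of c "real n"] cp by (simp add: W_def)
  qed
  moreover have "\<bar>(\<Sum>q\<in>{1..n}. W q) - (\<Sum>q\<in>{1..n}. dens m q)\<bar> \<le> real n / real P"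
  proof -
    have "\<bar>(\<Sum>q\<in>{1..n}. W q) - (\<Sum>q\<in>{1..n}. dens m q)\<bar> \<le> (\<Sum>q\<in>{1..n}. \<bar>W q - dens m q\<bar>)"
      unfolding sum_subtractf[symmetric] by (rule sum_abs)
    also have "\<dots> \<le> (\<Sum>q\<in>{1..n}. \<Sum>p | p \<in> prime_factors q \<and> p > P. 1 / real p)"
      using assms unfolding W_def S_def c_def by (intro sum_mono dens_approx) auto
    also have "\<dots> \<le> (\<Sum>q\<in>{1..n}. \<Sum>p\<in>{P<..n}. if p dvd q then 1 / real p else 0)"
    proof (rule sum_mono)
      fix q assume q: "q \<in> {1..n}"
      have "(\<Sum>p | p \<in> prime_factors q \<and> p > P. 1 / real p) \<le> (\<Sum>p | p \<in> {P<..n} \<and> p dvd q. 1 / real p)"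
        using q by (intro sum_mono2) (auto simp: in_prime_factors_iff dest: dvd_imp_le)
      also have "\<dots> = (\<Sum>p\<in>{P<..n}. if p dvd q then 1 / real p else 0)"
        by (subst sum.inter_filter) auto
      finally show "(\<Sum>p | p \<in> prime_factors q \<and> p > P. 1 / real p)
          \<le> (\<Sum>p\<in>{P<..n}. if p dvd q then 1 / real p else 0)" .
    qed
    \<comment> \<open>Each p divides at most n / p of the q up to n, so its weight 1 / p adds up to
      at most n / p^2.\<close>
    also have "\<dots> = (\<Sum>p\<in>{P<..n}. \<Sum>q\<in>{1..n}. if p dvd q then 1 / real p else 0)"
      by (rule sum.swap)
    also have "\<dots> \<le> (\<Sum>p\<in>{P<..n}. real n * (1 / (real p)\<^sup>2))"
    proof (rule sum_mono)
      fix p assume p: "p \<in> {P<..n}"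
      have "(\<Sum>q\<in>{1..n}. if p dvd q then 1 / real p else 0)
          = (\<Sum>q\<in>{q\<in>{1..nat \<lfloor>real n\<rfloor>}. p dvd q}. 1 / real p)"
        by (subst sum.inter_filter) auto
      also have "\<dots> = real (nat \<lfloor>real n / real p\<rfloor>) * (1 / real p)"
        using p by (subst sum_multiples_upto) auto
      also have "\<dots> \<le> real n / real p * (1 / real p)"
        by (intro mult_right_mono) (auto simp: of_nat_floor)
      finally show "(\<Sum>q\<in>{1..n}. if p dvd q then 1 / real p else 0) \<le> real n * (1 / (real p)\<^sup>2)"
        by (simp add: power2_eq_square)
    qed
    also have "\<dots> = real n * (\<Sum>p\<in>{P<..n}. 1 / (real p)\<^sup>2)" by (simp add: sum_distrib_left)
    also have "\<dots> \<le> real n * (1 / real P)"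
      using sum_inverse_squares_tail[OF assms(2)] by (intro mult_left_mono) auto
    finally show ?thesis by simp
  qed
  ultimately show ?thesis unfolding main S_def[symmetric] by linarith
qed

text \<open>P is fixed before n grows: the sieve error depends on m and P but not on n and vanishes
  after division by n, while 1 / P and the truncated product have been brought close to their limits
  beforehand.\<close>

lemma mean_dens:
  assumes "m > 0"
  shows "(\<lambda>n. (\<Sum>q\<in>{1..n}. dens m q) / real n) \<longlonglongrightarrow> C m"
proof (rule LIMSEQ_I)
  fix e :: real assume e: "e > 0"
  define M where "M = (\<lambda>P. real (totient m) / real m * (\<Prod>p\<le>P. euler_factor m p))"
  have "M \<longlonglongrightarrow> C m" unfolding M_def C_eq_prodinf[OF assms]
    by (intro tendsto_mult_left convergent_prod_LIMSEQ convergent_prod_euler_factor)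
  hence "\<forall>\<^sub>F P in sequentially. \<bar>M P - C m\<bar> < e / 3"
    using e tendstoD[of M "C m" sequentially "e / 3"] by (simp add: dist_real_def)
  moreover have "\<forall>\<^sub>F P in sequentially. 1 / real P < e / 3"
    using e order_tendstoD(2)[OF lim_1_over_n, of "e / 3"] by simp
  ultimately have "\<forall>\<^sub>F P in sequentially. \<bar>M P - C m\<bar> < e / 3 \<and> 1 / real P < e / 3 \<and> P \<ge> 1"
    using eventually_ge_at_top[of 1] by eventually_elim auto
  then obtain P where P: "\<bar>M P - C m\<bar> < e / 3" "1 / real P < e / 3" "P \<ge> 1"
    by (auto simp: eventually_sequentially)
  define K :: real where "K = 2 ^ card ({p. prime p \<and> p \<le> P} \<union> prime_factors m)"
  have "(\<lambda>n. K * (1 / real n)) \<longlonglongrightarrow> K * 0" by (intro tendsto_mult_left lim_1_over_n)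
  hence "\<forall>\<^sub>F n in sequentially. K / real n < e / 3"
    using e order_tendstoD(2)[of "\<lambda>n. K / real n" 0 sequentially "e / 3"] by simp
  hence "\<forall>\<^sub>F n in sequentially. norm ((\<Sum>q\<in>{1..n}. dens m q) / real n - C m) < e"
    using eventually_gt_at_top[of 0]
  proof eventually_elim
    case (elim n)
    have "\<bar>(\<Sum>q\<in>{1..n}. dens m q) - real n * M P\<bar> \<le> K + real n / real P"
      unfolding M_def K_def by (rule sum_dens_approx[OF assms P(3)])
    hence "\<bar>(\<Sum>q\<in>{1..n}. dens m q) - real n * M P\<bar> / real n \<le> (K + real n / real P) / real n"
      by (rule divide_right_mono) simp
    also have "\<bar>(\<Sum>q\<in>{1..n}. dens m q) - real n * M P\<bar> / real n
       = \<bar>((\<Sum>q\<in>{1..n}. dens m q) - real n * M P) / real n\<bar>" by simp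
    also have "((\<Sum>q\<in>{1..n}. dens m q) - real n * M P) / real n
       = (\<Sum>q\<in>{1..n}. dens m q) / real n - M P"
      using elim by (simp add: field_simps)
    also have "(K + real n / real P) / real n = K / real n + 1 / real P"
      using elim by (simp add: field_simps)
    finally show ?case using elim P unfolding real_norm_def by linarith
  qed
  thus "\<exists>no. \<forall>n\<ge>no. norm ((\<Sum>q\<in>{1..n}. dens m q) / real n - C m) < e"
    by (simp add: eventually_sequentially)
qed

section \<open>Weighted Riemann sums\<close>

lemma sum_blocks:
  fixes a :: "nat \<Rightarrow> nat" and F :: "nat \<Rightarrow> real"
  assumes "mono a"
  shows "(\<Sum>i<k. \<Sum>q\<in>{a i<..a (Suc i)}. F q) = (\<Sum>q\<in>{a 0<..a k}. F q)"
proof (induction k)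
  case (Suc k)
  have "{a 0<..a (Suc k)} = {a 0<..a k} \<union> {a k<..a (Suc k)}"
    using monoD[OF assms, of k "Suc k"] monoD[OF assms, of 0 k] by auto
  moreover have "{a 0<..a k} \<inter> {a k<..a (Suc k)} = {}" by auto
  ultimately show ?case using Suc by (simp add: sum.union_disjoint)
qed simp

lemma tendsto_mult_div_over:
  assumes "K > (0::nat)"
  shows "(\<lambda>n. real (i * n div K) / real n) \<longlonglongrightarrow> real i / real K"
proof (rule tendsto_sandwich)
  show "\<forall>\<^sub>F n in sequentially. real i / real K - 1 / real n \<le> real (i * n div K) / real n"
    using eventually_gt_at_top[of 0]
  proof eventually_elim
    case (elim n)
    have "real (i * n) / real K - 1 \<le> real (i * n div K)"
      using floor_divide_of_nat_eq[of "i * n" K, where 'a = real]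
        real_of_int_floor_gt_diff_one[of "real (i * n) / real K"] by simp
    hence "(real (i * n) / real K - 1) / real n \<le> real (i * n div K) / real n"
      by (rule divide_right_mono) simp
    thus ?case using elim by (simp add: diff_divide_distrib)
  qed
  show "\<forall>\<^sub>F n in sequentially. real (i * n div K) / real n \<le> real i / real K"
    using eventually_gt_at_top[of 0]
  proof eventually_elim
    case (elim n)
    have "real (i * n div K) \<le> real (i * n) / real K"
      using floor_divide_of_nat_eq[of "i * n" K, where 'a = real]
        of_int_floor_le[of "real (i * n) / real K"] by simp
    hence "real (i * n div K) / real n \<le> real (i * n) / real K / real n"
      by (rule divide_right_mono) simp
    thus ?case using elim by simp
  qed
  have "(\<lambda>n. real i / real K - 1 / real n) \<longlonglongrightarrow> real i / real K - 0"
    by (intro tendsto_intros lim_1_over_n)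
  thus "(\<lambda>n. real i / real K - 1 / real n) \<longlonglongrightarrow> real i / real K" by simp
qed auto

lemma riemann_sum_approx:
  fixes h :: "real \<Rightarrow> real"
  assumes "K > 0" "continuous_on {0..1} h"
    "\<And>s t. s \<in> {0..1} \<Longrightarrow> t \<in> {0..1} \<Longrightarrow> \<bar>s - t\<bar> \<le> 1 / real K \<Longrightarrow> \<bar>h s - h t\<bar> \<le> e"
  shows "\<bar>(\<Sum>i<K. h (real i / real K)) / real K - integral {0..1} h\<bar> \<le> e"
proof -
  have int: "h integrable_on {a..b}" if "0 \<le> a" "b \<le> 1" for a b
    using assms(2) that by (intro integrable_continuous_real) (auto elim: continuous_on_subset)
  have "\<bar>(\<Sum>i<k. h (real i / real K)) / real K - integral {0..real k / real K} h\<bar> \<le> real k * (e / real K)"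
    if "k \<le> K" for k
    using that
  proof (induction k)
    case (Suc k)
    define a b where "a = real k / real K" and "b = real (Suc k) / real K"
    have ab: "0 \<le> a" "a \<le> b" "b \<le> 1" "b - a = 1 / real K"
      using Suc.prems assms(1) by (auto simp: a_def b_def divide_right_mono divide_simps)
    have "integral {0..a} h + integral {a..b} h = integral {0..b} h"
      using ab by (intro Henstock_Kurzweil_Integration.integral_combine int) auto
    moreover have "\<bar>integral {a..b} h - h a / real K\<bar> \<le> e / real K"
    proof -
      have "((\<lambda>x. h x - h a) has_integral (integral {a..b} h - (b - a) * h a)) {a..b}"
        using ab has_integral_const_real[of "h a" a b]
        by (intro has_integral_diff integrable_integral int) auto
      moreover have "0 \<le> e" using assms(3)[of 0 0] by simp
      moreover have "norm (h x - h a) \<le> e" if "x \<in> {a..b}" for x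
        using assms(3)[of x a] that ab by (auto simp: abs_if)
      ultimately have "norm (integral {a..b} h - (b - a) * h a) \<le> e * measure lborel {a..b}"
        by (intro has_integral_bound_real) auto
      thus ?thesis using ab by simp
    qed
    moreover have "\<bar>(\<Sum>i<k. h (real i / real K)) / real K - integral {0..a} h\<bar> \<le> real k * (e / real K)"
      using Suc by (simp add: a_def)
    moreover have "(\<Sum>i<Suc k. h (real i / real K)) / real K
        = (\<Sum>i<k. h (real i / real K)) / real K + h a / real K"
      by (simp add: add_divide_distrib a_def)
    moreover have "real (Suc k) * (e / real K) = real k * (e / real K) + e / real K"
      by (simp add: algebra_simps add_divide_distrib)
    ultimately show ?case unfolding b_def[symmetric] by linarith
  qed simp
  from this[of K] show ?thesis using assms(1) by simp
qed

text \<open>On each of K blocks of {1..n}, h is nearly constant, and the mean, taken up to both ends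
  of the block, gives the block a total weight of about B n / K. Nonnegativity lets the variation of
  h be charged against the sum of f.\<close>

lemma weighted_riemann_sum:
  fixes f :: "nat \<Rightarrow> real" and h :: "real \<Rightarrow> real"
  assumes nonneg: "\<And>q. f q \<ge> 0"
    and mean: "(\<lambda>n. (\<Sum>q\<in>{1..n}. f q) / real n) \<longlonglongrightarrow> B"
    and cont: "continuous_on {0..1} h"
  shows "(\<lambda>n. (\<Sum>q\<in>{1..n}. f q * h (real q / real n)) / real n) \<longlonglongrightarrow> B * integral {0..1} h"
proof (rule LIMSEQ_I)
  fix r :: real assume r: "r > 0"
  have B: "B \<ge> 0"
    by (rule tendsto_lowerbound[OF mean]) (auto intro!: always_eventually divide_nonneg_nonneg sum_nonneg nonneg)
  \<comment> \<open>Three errors are to add up to less than r: e (B + 1) from the variation of h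
    inside the blocks, B e from the Riemann sum, and e from the convergence of R.\<close>
  define e where "e = r / (2 * B + 4)"
  have "e > 0" "e * (2 * B + 4) = r" using r B by (auto simp: e_def)
  hence e: "e > 0" "e * (B + 1) + B * e + e < r" by (auto simp: algebra_simps)
  define S where "S = (\<lambda>n. \<Sum>q\<in>{1..n}. f q)"
  have "uniformly_continuous_on {0..1} h"
    using cont by (intro compact_uniformly_continuous) auto
  then obtain d where d: "d > 0"
    "\<And>s t. s \<in> {0..1} \<Longrightarrow> t \<in> {0..1} \<Longrightarrow> \<bar>s - t\<bar> < d \<Longrightarrow> \<bar>h s - h t\<bar> < e"
    using e(1) unfolding uniformly_continuous_on_def dist_real_def by metis
  obtain K where K: "K > 0" "1 / real K < d"
    using d(1) by (metis nat_approx_posE zero_less_Suc)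
  have h: "\<bar>h s - h t\<bar> \<le> e" if "s \<in> {0..1}" "t \<in> {0..1}" "\<bar>s - t\<bar> \<le> 1 / real K" for s t
    using d(2)[of s t] that K by linarith
  define a where "a = (\<lambda>n i. i * n div K)"
  have Sa: "(\<lambda>n. S (a n i) / real n) \<longlonglongrightarrow> B * (real i / real K)" for i
  proof (cases "i = 0")
    case False
    have top: "filterlim (\<lambda>n. a n i) at_top sequentially"
      unfolding filterlim_at_top
    proof
      fix Z
      show "\<forall>\<^sub>F n in sequentially. Z \<le> a n i"
        using eventually_ge_at_top[of "Z * K"]
      proof eventually_elim
        case (elim n)
        have "Z * K \<le> i * n" using elim False by (cases i) (auto intro: trans_le_add1)
        thus ?case using K(1) by (simp add: a_def less_eq_div_iff_mult_less_eq)
      qed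
    qed
    have "(\<lambda>n. S (a n i) / real (a n i) * (real (a n i) / real n)) \<longlonglongrightarrow> B * (real i / real K)"
      using filterlim_compose[OF mean top] tendsto_mult_div_over[OF K(1), of i]
      by (intro tendsto_mult) (auto simp: S_def a_def)
    moreover have "\<forall>\<^sub>F n in sequentially.
        S (a n i) / real (a n i) * (real (a n i) / real n) = S (a n i) / real n"
      using top[unfolded filterlim_at_top, THEN spec, of 1] by eventually_elim auto
    ultimately show ?thesis by (rule Lim_transform_eventually)
  qed (simp add: a_def S_def)
  define R where "R = (\<lambda>n. (\<Sum>i<K. h (real i / real K) * (S (a n (Suc i)) - S (a n i))) / real n)"
  have "(\<lambda>n. \<Sum>i<K. h (real i / real K) * (S (a n (Suc i)) / real n - S (a n i) / real n))
     \<longlonglongrightarrow> (\<Sum>i<K. h (real i / real K) * (B * (real (Suc i) / real K) - B * (real i / real K)))"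
    by (intro tendsto_intros Sa)
  also have "(\<lambda>n. \<Sum>i<K. h (real i / real K) * (S (a n (Suc i)) / real n - S (a n i) / real n)) = R"
    by (simp add: R_def sum_divide_distrib flip: diff_divide_distrib)
  also have "(\<Sum>i<K. h (real i / real K) * (B * (real (Suc i) / real K) - B * (real i / real K)))
      = B * ((\<Sum>i<K. h (real i / real K)) / real K)"
    by (simp add: sum_divide_distrib sum_distrib_left field_simps)
  finally have "R \<longlonglongrightarrow> B * ((\<Sum>i<K. h (real i / real K)) / real K)" .
  hence ev1: "\<forall>\<^sub>F n in sequentially. \<bar>R n - B * ((\<Sum>i<K. h (real i / real K)) / real K)\<bar> < e"
    using e(1) tendstoD by (fastforce simp: dist_real_def)
  have ev2: "\<forall>\<^sub>F n in sequentially. S n / real n < B + 1"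
    using mean by (auto simp: S_def intro: order_tendstoD)
  have "\<forall>\<^sub>F n in sequentially.
     norm ((\<Sum>q\<in>{1..n}. f q * h (real q / real n)) / real n - B * integral {0..1} h) < r"
    using ev1 ev2 eventually_gt_at_top[of 0]
  proof eventually_elim
    case (elim n)
    have mono: "mono (a n)" unfolding a_def by (intro monoI div_le_mono mult_le_mono1)
    have a0: "a n 0 = 0" "a n K = n" using K(1) by (auto simp: a_def)
    have blocks: "(\<Sum>q\<in>{1..n}. F q) = (\<Sum>i<K. \<Sum>q\<in>{a n i<..a n (Suc i)}. F q)" for F :: "nat \<Rightarrow> real"
    proof -
      have "{0<..n} = {1..n}" by auto
      thus ?thesis using sum_blocks[OF mono, of F K] by (simp add: a0)
    qed
    have Sdiff: "S (a n (Suc i)) - S (a n i) = (\<Sum>q\<in>{a n i<..a n (Suc i)}. f q)" for i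
    proof -
      have "a n i \<le> a n (Suc i)" using mono by (simp add: monoD)
      hence "{1..a n (Suc i)} = {1..a n i} \<union> {a n i<..a n (Suc i)}" by auto
      hence "S (a n (Suc i)) = S (a n i) + (\<Sum>q\<in>{a n i<..a n (Suc i)}. f q)"
        unfolding S_def by (simp only:) (rule sum.union_disjoint, auto)
      thus ?thesis by simp
    qed
    have "(\<Sum>q\<in>{1..n}. f q * h (real q / real n)) - R n * real n
        = (\<Sum>i<K. \<Sum>q\<in>{a n i<..a n (Suc i)}. f q * (h (real q / real n) - h (real i / real K)))"
    proof -
      have "R n * real n = (\<Sum>i<K. h (real i / real K) * (S (a n (Suc i)) - S (a n i)))"
        using elim(3) by (simp add: R_def)
      thus ?thesis unfolding blocks Sdiff
        by (simp add: sum_subtractf right_diff_distrib sum_distrib_left mult.commute)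
    qed
    also have "\<bar>\<dots>\<bar> \<le> (\<Sum>i<K. \<Sum>q\<in>{a n i<..a n (Suc i)}. f q * e)"
    proof (intro order_trans[OF sum_abs] sum_mono)
      fix i q assume i: "i \<in> {..<K}" and q: "q \<in> {a n i<..a n (Suc i)}"
      have "i * n < q * K" "q * K \<le> Suc i * n"
        using q K(1) by (auto simp: a_def less_eq_div_iff_mult_less_eq div_less_iff_less_mult)
      hence q1: "real i * real n < real q * real K" "real q * real K \<le> real (Suc i) * real n"
        by (metis of_nat_less_iff of_nat_mult, metis of_nat_le_iff of_nat_mult)
      have q2: "real i / real K < real q / real n" "real q / real n \<le> real (Suc i) / real K"
        using q1 elim(3) K(1) by (auto simp: field_simps)
      have "real (Suc i) / real K \<le> 1" using i by simp
      moreover have "real (Suc i) / real K = real i / real K + 1 / real K"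
        by (simp add: add_divide_distrib)
      moreover have "real i / real K \<ge> 0" by simp
      ultimately have "\<bar>h (real q / real n) - h (real i / real K)\<bar> \<le> e"
        using q2 by (intro h) (auto simp del: of_nat_Suc)
      thus "\<bar>f q * (h (real q / real n) - h (real i / real K))\<bar> \<le> f q * e"
        using nonneg[of q] by (simp add: abs_mult mult_left_mono)
    qed
    also have "\<dots> = S n * e" unfolding S_def blocks by (simp add: sum_distrib_right)
    finally have "\<bar>(\<Sum>q\<in>{1..n}. f q * h (real q / real n)) - R n * real n\<bar> / real n \<le> S n * e / real n"
      by (rule divide_right_mono) simp
    also have "\<bar>(\<Sum>q\<in>{1..n}. f q * h (real q / real n)) - R n * real n\<bar> / real n
       = \<bar>((\<Sum>q\<in>{1..n}. f q * h (real q / real n)) - R n * real n) / real n\<bar>" by simp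
    also have "((\<Sum>q\<in>{1..n}. f q * h (real q / real n)) - R n * real n) / real n
       = (\<Sum>q\<in>{1..n}. f q * h (real q / real n)) / real n - R n"
      using elim(3) by (simp add: field_simps)
    also have "S n * e / real n = e * (S n / real n)" by simp
    also have "\<dots> \<le> e * (B + 1)" using elim(2) e(1) by (intro mult_left_mono) auto
    finally have 1: "\<bar>(\<Sum>q\<in>{1..n}. f q * h (real q / real n)) / real n - R n\<bar> \<le> e * (B + 1)" .
    have "B * \<bar>(\<Sum>i<K. h (real i / real K)) / real K - integral {0..1} h\<bar> \<le> B * e"
      by (intro mult_left_mono riemann_sum_approx K cont h B) auto
    also have "B * \<bar>(\<Sum>i<K. h (real i / real K)) / real K - integral {0..1} h\<bar>
       = \<bar>B * ((\<Sum>i<K. h (real i / real K)) / real K) - B * integral {0..1} h\<bar>"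
      unfolding right_diff_distrib[symmetric] using B by (simp add: abs_mult)
    finally show ?case using 1 elim(1) e(2) unfolding real_norm_def by linarith
  qed
  thus "\<exists>no. \<forall>n\<ge>no. norm ((\<Sum>q\<in>{1..n}. f q * h (real q / real n)) / real n - B * integral {0..1} h) < r"
    by (simp add: eventually_sequentially)
qed

text \<open>Common shape of the two integrals evaluated later: the integrand vanishes up to a
  threshold a and has an explicit antiderivative beyond it.\<close>

lemma has_integral_zero_then_antiderivative:
  fixes f F :: "real \<Rightarrow> real"
  assumes "0 \<le> a" "a \<le> b" "\<And>x. x \<in> {0..a} \<Longrightarrow> f x = 0"
    "\<And>x. x \<in> {a..b} \<Longrightarrow> (F has_real_derivative f x) (at x within {a..b})"
  shows "(f has_integral (F b - F a)) {0..b}"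
proof -
  have "(f has_integral 0) {0..a}" using assms(3) by (intro has_integral_is_0) auto
  moreover have "(f has_integral (F b - F a)) {a..b}"
    using assms by (intro fundamental_theorem_of_calculus)
      (auto simp: has_real_derivative_iff_has_vector_derivative)
  ultimately have "(f has_integral (0 + (F b - F a))) {0..b}"
    using assms by (intro has_integral_combine[of 0 a b])
  thus ?thesis by simp
qed

text \<open>For 0 < t < 1 this is the area of the part of the unit square where the product of the
  coordinates exceeds t; for t \<ge> 1 that part is empty. It is the limiting shape of the condition
  D n^2 < c q s in the coordinates q / n and s / (\<rho> n), with t = D / (c \<rho>).\<close>

definition Phi :: "real \<Rightarrow> real" where
  "Phi t = (if t < 1 then 1 - t + t * ln t else 0)"

text \<open>Writing \<open>max t \<tau>\<close> makes the integrand vanish below \<tau> and keeps it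
  continuous on [0, 1], whereas \<tau> / t would blow up at 0.\<close>

lemma integral_Phi:
  assumes "\<tau> > 0"
  shows "integral {0..1} (\<lambda>t. 1 - \<tau> / max t \<tau>) = Phi \<tau>"
proof (cases "\<tau> < 1")
  case True
  have "((\<lambda>t. 1 - \<tau> / max t \<tau>) has_integral ((1 - \<tau> * ln 1) - (\<tau> - \<tau> * ln \<tau>))) {0..1}"
    using assms True
    by (intro has_integral_zero_then_antiderivative[where F = "\<lambda>t. t - \<tau> * ln t" and a = \<tau>])
       (auto intro!: derivative_eq_intros simp: max_def)
  thus ?thesis using True by (simp add: Phi_def integral_unique)
next
  case False
  have "integral {0..1} (\<lambda>t. 1 - \<tau> / max t \<tau>) = integral {0..1} (\<lambda>t::real. 0::real)"
    using False by (intro integral_cong) (auto simp: max_def)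
  thus ?thesis using False by (simp add: Phi_def)
qed

section \<open>Pairs of fractions with given determinant\<close>

text \<open>The pairs \<open>a / q < b / s\<close> with \<open>b q - a s = D\<close> and distance \<open>D / (q s) < c / n\<^sup>2\<close>; only the first fraction is
  required to be reduced, and \<open>\<rho>\<close> allows the second denominator its own range \<open>\<rho> n\<close>.\<close>

definition quads :: "nat \<Rightarrow> nat \<Rightarrow> real \<Rightarrow> real \<Rightarrow> nat \<Rightarrow> (nat \<times> nat \<times> nat \<times> nat) set" where
  "quads m n \<rho> c D = {(a, q, b, s). 1 \<le> a \<and> a \<le> q \<and> q \<le> n \<and> coprime a q \<and> coprime q m \<and>
     1 \<le> s \<and> real s \<le> \<rho> * real n \<and> coprime s m \<and> b * q = a * s + D \<and>
     real D * (real n)\<^sup>2 < c * real q * real s}"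

definition prim_quads :: "nat \<Rightarrow> nat \<Rightarrow> real \<Rightarrow> real \<Rightarrow> nat \<Rightarrow> (nat \<times> nat \<times> nat \<times> nat) set" where
  "prim_quads m n \<rho> c D = {(a, q, b, s) \<in> quads m n \<rho> c D. coprime b s}"

lemma le_nat_floor_iff:
  assumes "s \<ge> 1"
  shows "s \<le> nat \<lfloor>y\<rfloor> \<longleftrightarrow> real s \<le> y"
  using assms by (cases "y \<ge> 0") (auto simp: le_nat_iff le_floor_iff)

lemma finite_quads [simp]: "finite (quads m n \<rho> c D)"
proof (rule finite_subset)
  show "quads m n \<rho> c D \<subseteq> {..n} \<times> {..n} \<times> {..n * nat \<lfloor>\<rho> * real n\<rfloor> + D} \<times> {..nat \<lfloor>\<rho> * real n\<rfloor>}"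
  proof
    fix x assume x: "x \<in> quads m n \<rho> c D"
    obtain a q b s where abcd: "x = (a, q, b, s)" by (cases x)
    with x have *: "1 \<le> a" "a \<le> q" "q \<le> n" "real s \<le> \<rho> * real n" "b * q = a * s + D"
      by (auto simp: quads_def)
    have s: "s \<le> nat \<lfloor>\<rho> * real n\<rfloor>" using *(4) by (simp add: le_nat_floor)
    have "b \<le> b * q" using *(1,2) by (cases q) auto
    also have "\<dots> \<le> n * nat \<lfloor>\<rho> * real n\<rfloor> + D"
      unfolding *(5) using * s by (intro add_mono mult_le_mono) auto
    finally show "x \<in> {..n} \<times> {..n} \<times> {..n * nat \<lfloor>\<rho> * real n\<rfloor> + D} \<times> {..nat \<lfloor>\<rho> * real n\<rfloor>}"
      using * s by (simp add: abcd)
  qed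
qed auto

lemma finite_prim_quads [simp]: "finite (prim_quads m n \<rho> c D)"
  by (rule finite_subset[OF _ finite_quads[of m n \<rho> c D]]) (auto simp: prim_quads_def)

text \<open>The numerator b is determined by a, q and s, so a quadruple amounts to a choice of q, s
  and a solution a of the congruence.\<close>

lemma card_quads:
  "card (quads m n \<rho> c D) = (\<Sum>q\<in>{q\<in>{1..n}. coprime q m}.
     \<Sum>s\<in>{s\<in>{1..nat \<lfloor>\<rho> * real n\<rfloor>}. coprime s m \<and> real D * (real n)\<^sup>2 < c * real q * real s}.
       card (unit_sols q D s))"
proof -
  define Q where "Q = {q\<in>{1..n}. coprime q m}"
  define J where "J = (\<lambda>q. {s\<in>{1..nat \<lfloor>\<rho> * real n\<rfloor>}. coprime s m \<and> real D * (real n)\<^sup>2 < c * real q * real s})"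
  have "bij_betw (\<lambda>(q, s, a). (a, q, (a * s + D) div q, s))
          (SIGMA q:Q. SIGMA s:J q. unit_sols q D s) (quads m n \<rho> c D)"
  proof (rule bij_betw_byWitness[where f' = "\<lambda>(a, q, b, s). (q, s, a)"])
    show "(\<lambda>(q, s, a). (a, q, (a * s + D) div q, s)) ` (SIGMA q:Q. SIGMA s:J q. unit_sols q D s)
            \<subseteq> quads m n \<rho> c D"
      by (auto simp: Q_def J_def unit_sols_def quads_def le_nat_floor_iff)
    show "(\<lambda>(a, q, b, s). (q, s, a)) ` quads m n \<rho> c D \<subseteq> (SIGMA q:Q. SIGMA s:J q. unit_sols q D s)"
    proof (rule image_subsetI)
      fix x assume x: "x \<in> quads m n \<rho> c D"
      obtain a q b s where abcd: "x = (a, q, b, s)" by (cases x)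
      with x have *: "1 \<le> a" "a \<le> q" "q \<le> n" "coprime a q" "coprime q m" "1 \<le> s" "coprime s m"
         "real s \<le> \<rho> * real n" "b * q = a * s + D" "real D * (real n)\<^sup>2 < c * real q * real s"
        by (auto simp: quads_def)
      have "q dvd a * s + D" by (metis *(9) dvd_triv_right)
      hence "q \<in> Q" "s \<in> J q" "a \<in> unit_sols q D s"
        using * by (auto simp: Q_def J_def unit_sols_def le_nat_floor)
      thus "(case x of (a, q, b, s) \<Rightarrow> (q, s, a)) \<in> (SIGMA q:Q. SIGMA s:J q. unit_sols q D s)"
        by (simp add: abcd)
    qed
    show "\<forall>y\<in>quads m n \<rho> c D. (case case y of (a, q, b, s) \<Rightarrow> (q, s, a) of
        (q, s, a) \<Rightarrow> (a, q, (a * s + D) div q, s)) = y"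
    proof
      fix y assume y: "y \<in> quads m n \<rho> c D"
      obtain a q b s where abcd: "y = (a, q, b, s)" by (cases y)
      with y have "b * q = a * s + D" "q > 0" by (auto simp: quads_def)
      hence "(a * s + D) div q = b" by (metis div_mult_self_is_m)
      thus "(case case y of (a, q, b, s) \<Rightarrow> (q, s, a) of
        (q, s, a) \<Rightarrow> (a, q, (a * s + D) div q, s)) = y" by (simp add: abcd)
    qed
  qed (auto simp: Q_def J_def unit_sols_def quads_def)
  hence "card (quads m n \<rho> c D) = card (SIGMA q:Q. SIGMA s:J q. unit_sols q D s)"
    by (simp add: bij_betw_same_card)
  also have "\<dots> = (\<Sum>q\<in>Q. \<Sum>s\<in>J q. card (unit_sols q D s))"
    by (subst card_SigmaI) (auto simp: Q_def J_def intro!: sum.cong card_SigmaI)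
  finally show ?thesis by (simp add: Q_def J_def)
qed

lemma sum_unit_sols_hyperbola:
  assumes "m > 0" "D > 0" "c > 0" "\<rho> > 0" "q > 0" "n > 0" "coprime q m"
  defines "\<tau> \<equiv> real D / (c * \<rho>)"
  shows "\<bar>(\<Sum>s\<in>{s\<in>{1..nat \<lfloor>\<rho> * real n\<rfloor>}. coprime s m \<and> real D * (real n)\<^sup>2 < c * real q * real s}.
            real (card (unit_sols q D s)))
          - real (totient m) / real m * \<rho> * real n * (dens m q * (1 - \<tau> / max (real q / real n) \<tau>))\<bar>
       \<le> 4 * real D * 2 ^ card (prime_factors m) * sqrt (real q)"
proof -
  define u where "u = (\<lambda>s. real (card (unit_sols q D s)))"
  define A where "A = (\<lambda>y::real. {s\<in>{1..nat \<lfloor>y\<rfloor>}. coprime s m})"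
  \<comment> \<open>The lower end of the range of s. With the cap at \<rho> n, the range is empty
    and the main term 0 exactly when q / n \<le> \<tau>.\<close>
  define y where "y = min (\<rho> * real n) (real D * (real n)\<^sup>2 / (c * real q))"
  define \<kappa> where "\<kappa> = real (totient m) / real m * (real (totient q) / real q)"
  define E :: real where "E = real D * 2 ^ card (prime_factors m) * 2 ^ card (prime_factors q)"
  have y: "0 \<le> y" "y \<le> \<rho> * real n" using assms by (auto simp: y_def)
  have AE: "\<bar>sum u (A z) - z * \<kappa>\<bar> \<le> E" if "z \<ge> 0" for z
    using sum_card_unit_sols_coprime[of q D m z] assms that by (simp add: u_def A_def \<kappa>_def E_def mult.assoc)
  have "\<tau> > 0" using assms by (simp add: \<tau>_def)
  have "y = \<rho> * real n * (\<tau> / max (real q / real n) \<tau>)"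
  proof (cases "real q / real n \<le> \<tau>")
    case True
    hence "\<rho> * real n \<le> real D * (real n)\<^sup>2 / (c * real q)"
      using assms by (simp add: \<tau>_def field_simps power2_eq_square)
    thus ?thesis using True \<open>\<tau> > 0\<close> by (simp add: y_def max_def)
  next
    case False
    hence "\<rho> * real n \<ge> real D * (real n)\<^sup>2 / (c * real q)"
      using assms by (simp add: \<tau>_def field_simps power2_eq_square)
    thus ?thesis using False \<open>\<tau> > 0\<close> assms(1-6) by (simp add: y_def max_def \<tau>_def power2_eq_square)
  qed
  hence main: "real (totient m) / real m * \<rho> * real n * (dens m q * (1 - \<tau> / max (real q / real n) \<tau>))
      = (\<rho> * real n - y) * \<kappa>"
    using assms by (simp add: dens_def \<kappa>_def algebra_simps)
  have "{s\<in>{1..nat \<lfloor>\<rho> * real n\<rfloor>}. coprime s m \<and> real D * (real n)\<^sup>2 < c * real q * real s}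
      = A (\<rho> * real n) - A y"
  proof -
    have "real D * (real n)\<^sup>2 < c * real q * real s \<longleftrightarrow> \<not> s \<le> nat \<lfloor>y\<rfloor>"
      if "s \<le> nat \<lfloor>\<rho> * real n\<rfloor>" for s
    proof -
      have "real s \<le> \<rho> * real n" using that assms by (simp add: le_nat_iff le_floor_iff)
      moreover have "s \<le> nat \<lfloor>y\<rfloor> \<longleftrightarrow> real s \<le> y" using y by (simp add: le_nat_iff le_floor_iff)
      ultimately have "s \<le> nat \<lfloor>y\<rfloor> \<longleftrightarrow> real s \<le> real D * (real n)\<^sup>2 / (c * real q)"
        by (simp add: y_def)
      also have "\<dots> \<longleftrightarrow> \<not> real D * (real n)\<^sup>2 < c * real q * real s"
        using assms by (simp add: field_simps not_less)
      finally show ?thesis by blast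
    qed
    thus ?thesis by (auto simp: A_def)
  qed
  moreover have "A y \<subseteq> A (\<rho> * real n)"
    using nat_mono[OF floor_mono[OF y(2)]] by (auto simp: A_def)
  ultimately have "(\<Sum>s\<in>{s\<in>{1..nat \<lfloor>\<rho> * real n\<rfloor>}. coprime s m \<and> real D * (real n)\<^sup>2 < c * real q * real s}. u s)
      = sum u (A (\<rho> * real n)) - sum u (A y)"
    by (simp add: sum_diff A_def)
  \<comment> \<open>One sieve error for each end of the range.\<close>
  moreover have "\<bar>sum u (A (\<rho> * real n)) - sum u (A y) - (\<rho> * real n - y) * \<kappa>\<bar> \<le> 2 * E"
    using AE[of "\<rho> * real n"] AE[of y] y assms unfolding left_diff_distrib by fastforce
  moreover have "2 * E \<le> 4 * real D * 2 ^ card (prime_factors m) * sqrt (real q)"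
  proof -
    have "2 * E \<le> 2 * (real D * 2 ^ card (prime_factors m) * (2 * sqrt (real q)))"
      unfolding E_def using two_power_card_prime_factors_le[of q] assms
      by (intro mult_left_mono) auto
    thus ?thesis by simp
  qed
  ultimately show ?thesis unfolding main u_def[symmetric] by linarith
qed

text \<open>Errors of order sqrt n for each q add up to order n^(3/2), negligible against n^2; the
  main terms form a Riemann sum for h with weights \<open>dens m q\<close>.\<close>

lemma card_quads_asymp:
  assumes "m > 0" "D > 0" "c > 0" "\<rho> > 0"
  shows "(\<lambda>n. real (card (quads m n \<rho> c D)) / (real n)\<^sup>2)
     \<longlonglongrightarrow> real (totient m) / real m * C m * \<rho> * Phi (real D / (c * \<rho>))"
proof -
  define \<tau> where "\<tau> = real D / (c * \<rho>)"
  define h where "h = (\<lambda>t. 1 - \<tau> / max t \<tau>)"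
  define \<beta> where "\<beta> = real (totient m) / real m * \<rho>"
  define K where "K = 4 * real D * 2 ^ card (prime_factors m)"
  have \<tau>: "\<tau> > 0" using assms by (simp add: \<tau>_def)
  have "continuous_on {0..1} h"
    unfolding h_def using \<tau> by (intro continuous_intros) (auto simp: max_def)
  hence "(\<lambda>n. (\<Sum>q\<in>{1..n}. dens m q * h (real q / real n)) / real n) \<longlonglongrightarrow> C m * integral {0..1} h"
    using assms by (intro weighted_riemann_sum mean_dens dens_bounds)
  also have "integral {0..1} h = Phi \<tau>" unfolding h_def using \<tau> by (rule integral_Phi)
  finally have main: "(\<lambda>n. \<beta> * ((\<Sum>q\<in>{1..n}. dens m q * h (real q / real n)) / real n)) \<longlonglongrightarrow> \<beta> * (C m * Phi \<tau>)"
    by (rule tendsto_mult_left)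
  have err: "(\<lambda>n. real (card (quads m n \<rho> c D)) / (real n)\<^sup>2
     - \<beta> * ((\<Sum>q\<in>{1..n}. dens m q * h (real q / real n)) / real n)) \<longlonglongrightarrow> 0"
  proof (rule Lim_null_comparison)
    show "\<forall>\<^sub>F n in sequentially. norm (real (card (quads m n \<rho> c D)) / (real n)\<^sup>2
        - \<beta> * ((\<Sum>q\<in>{1..n}. dens m q * h (real q / real n)) / real n)) \<le> K * (1 / sqrt (real n))"
      using eventually_gt_at_top[of 0]
    proof eventually_elim
      case (elim n)
      define Q where "Q = {q\<in>{1..n}. coprime q m}"
      define V where "V = (\<lambda>q. \<Sum>s\<in>{s\<in>{1..nat \<lfloor>\<rho> * real n\<rfloor>}. coprime s m \<and> real D * (real n)\<^sup>2 < c * real q * real s}.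
            real (card (unit_sols q D s)))"
      have "(\<Sum>q\<in>{1..n}. dens m q * h (real q / real n)) = (\<Sum>q\<in>Q. dens m q * h (real q / real n))"
        unfolding Q_def by (rule sum.mono_neutral_right) (auto simp: dens_def)
      hence "real (card (quads m n \<rho> c D)) - \<beta> * real n * (\<Sum>q\<in>{1..n}. dens m q * h (real q / real n))
         = (\<Sum>q\<in>Q. V q - \<beta> * real n * (dens m q * h (real q / real n)))"
        by (simp add: card_quads Q_def V_def sum_subtractf sum_distrib_left)
      also have "\<bar>\<dots>\<bar> \<le> (\<Sum>q\<in>Q. K * sqrt (real q))"
      proof (intro order_trans[OF sum_abs] sum_mono)
        fix q assume "q \<in> Q"
        thus "\<bar>V q - \<beta> * real n * (dens m q * h (real q / real n))\<bar> \<le> K * sqrt (real q)"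
          using sum_unit_sols_hyperbola[OF assms, of q n] elim
          by (auto simp: Q_def V_def \<beta>_def h_def \<tau>_def K_def)
      qed
      also have "\<dots> \<le> (\<Sum>q\<in>{1..n}. K * sqrt (real n))"
      proof (rule order_trans[OF sum_mono])
        show "K * sqrt (real q) \<le> K * sqrt (real n)" if "q \<in> Q" for q
          using that by (intro mult_left_mono) (auto simp: Q_def K_def)
        show "(\<Sum>q\<in>Q. K * sqrt (real n)) \<le> (\<Sum>q\<in>{1..n}. K * sqrt (real n))"
          by (intro sum_mono2) (auto simp: Q_def K_def)
      qed
      also have "\<dots> = real n * (K * sqrt (real n))" by simp
      finally have "\<bar>real (card (quads m n \<rho> c D)) - \<beta> * real n * (\<Sum>q\<in>{1..n}. dens m q * h (real q / real n))\<bar>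
          / (real n)\<^sup>2 \<le> real n * (K * sqrt (real n)) / (real n)\<^sup>2"
        by (rule divide_right_mono) simp
      also have "real n * (K * sqrt (real n)) / (real n)\<^sup>2 = K * (sqrt (real n) / real n)"
        using elim by (simp add: power2_eq_square)
      also have "sqrt (real n) / real n = 1 / sqrt (real n)"
        using elim by (simp add: field_simps)
      finally have "\<bar>real (card (quads m n \<rho> c D)) - \<beta> * real n * (\<Sum>q\<in>{1..n}. dens m q * h (real q / real n))\<bar>
          / (real n)\<^sup>2 \<le> K * (1 / sqrt (real n))" .
      moreover have "real (card (quads m n \<rho> c D)) / (real n)\<^sup>2
          - \<beta> * ((\<Sum>q\<in>{1..n}. dens m q * h (real q / real n)) / real n)
        = (real (card (quads m n \<rho> c D)) - \<beta> * real n * (\<Sum>q\<in>{1..n}. dens m q * h (real q / real n)))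
          / (real n)\<^sup>2"
        using elim by (simp add: power2_eq_square diff_divide_distrib)
      ultimately show ?case by (simp only: real_norm_def abs_divide abs_power2)
    qed
    have "(\<lambda>n. sqrt (1 / real n)) \<longlonglongrightarrow> sqrt 0" by (intro tendsto_real_sqrt lim_1_over_n)
    hence "(\<lambda>n. 1 / sqrt (real n)) \<longlonglongrightarrow> 0" by (simp add: real_sqrt_divide)
    from tendsto_mult_left[OF this, of K]
    show "(\<lambda>n. K * (1 / sqrt (real n))) \<longlonglongrightarrow> 0" by simp
  qed
  have "(\<lambda>n. real (card (quads m n \<rho> c D)) / (real n)\<^sup>2) \<longlonglongrightarrow> \<beta> * (C m * Phi \<tau>)"
    using tendsto_add[OF err main] by simp
  thus ?thesis by (simp add: \<beta>_def \<tau>_def mult_ac)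
qed

text \<open>With k = gcd b s, k divides b q - a s = D, and k is coprime to m because s is. Dividing
  b, s and D by k leaves a / q alone, preserves the inequality between D n^2 and c q s, and shortens
  the range of s by the factor k.\<close>

lemma card_quads_decomp:
  assumes "D > 0"
  shows "card (quads m n \<rho> c D) =
    (\<Sum>k | k dvd D \<and> coprime k m. card (prim_quads m n (\<rho> / real k) c (D div k)))"
proof -
  define Ks where "Ks = {k. k dvd D \<and> coprime k m}"
  have fin: "finite Ks" using assms by (simp add: Ks_def)
  have "bij_betw (\<lambda>(k, a, q, b, s). (a, q, k * b, k * s))
     (SIGMA k:Ks. prim_quads m n (\<rho> / real k) c (D div k)) (quads m n \<rho> c D)"
  proof (rule bij_betw_byWitness[where f' = "\<lambda>(a, q, b, s). (gcd b s, a, q, b div gcd b s, s div gcd b s)"])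
    show "\<forall>x\<in>SIGMA k:Ks. prim_quads m n (\<rho> / real k) c (D div k).
       (case case x of (k, a, q, b, s) \<Rightarrow> (a, q, k * b, k * s) of
          (a, q, b, s) \<Rightarrow> (gcd b s, a, q, b div gcd b s, s div gcd b s)) = x"
    proof
      fix x assume "x \<in> (SIGMA k:Ks. prim_quads m n (\<rho> / real k) c (D div k))"
      then obtain k a q b s where x: "x = (k, a, q, b, s)" and k: "k \<in> Ks"
        and "(a, q, b, s) \<in> prim_quads m n (\<rho> / real k) c (D div k)" by (cases x) auto
      hence "gcd b s = 1" by (simp add: prim_quads_def coprime_iff_gcd_eq_1)
      hence g: "gcd (k * b) (k * s) = k" by (simp add: gcd_mult_distrib_nat[symmetric])
      have "k > 0" using k assms by (auto simp: Ks_def intro!: Nat.gr0I)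
      thus "(case case x of (k, a, q, b, s) \<Rightarrow> (a, q, k * b, k * s) of
          (a, q, b, s) \<Rightarrow> (gcd b s, a, q, b div gcd b s, s div gcd b s)) = x"
        using g by (simp add: x)
    qed
    show "\<forall>y\<in>quads m n \<rho> c D. (case case y of (a, q, b, s) \<Rightarrow> (gcd b s, a, q, b div gcd b s, s div gcd b s)
         of (k, a, q, b, s) \<Rightarrow> (a, q, k * b, k * s)) = y"
      by auto
    show "(\<lambda>(k, a, q, b, s). (a, q, k * b, k * s)) ` (SIGMA k:Ks. prim_quads m n (\<rho> / real k) c (D div k))
        \<subseteq> quads m n \<rho> c D"
    proof (rule image_subsetI)
      fix x assume "x \<in> (SIGMA k:Ks. prim_quads m n (\<rho> / real k) c (D div k))"
      then obtain k a q b s where x: "x = (k, a, q, b, s)" and k: "k \<in> Ks"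
        and "(a, q, b, s) \<in> prim_quads m n (\<rho> / real k) c (D div k)" by (cases x) auto
      hence *: "1 \<le> a" "a \<le> q" "q \<le> n" "coprime a q" "coprime q m" "1 \<le> s" "coprime s m"
         "real s \<le> \<rho> / real k * real n" "b * q = a * s + D div k"
         "real (D div k) * (real n)\<^sup>2 < c * real q * real s"
        by (auto simp: quads_def prim_quads_def)
      have k': "k > 0" "k * (D div k) = D" "coprime k m"
        using k assms by (auto simp: Ks_def intro!: Nat.gr0I)
      have "k * b * q = a * (k * s) + D"
        using *(9) k'(2) by (metis add_mult_distrib2 mult.assoc mult.left_commute)
      moreover have "real (k * s) \<le> \<rho> * real n"
        using *(8) k'(1) by (simp add: field_simps)
      moreover have "real D * (real n)\<^sup>2 < c * real q * real (k * s)"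
      proof -
        have "real k * (real (D div k) * (real n)\<^sup>2) < real k * (c * real q * real s)"
          using *(10) k' by simp
        moreover have "real k * real (D div k) = real D" using k'(2) by (metis of_nat_mult)
        hence "real k * (real (D div k) * (real n)\<^sup>2) = real D * (real n)\<^sup>2"
          by (simp add: mult.assoc[symmetric])
        ultimately show ?thesis by (simp add: mult_ac)
      qed
      ultimately show "(case x of (k, a, q, b, s) \<Rightarrow> (a, q, k * b, k * s)) \<in> quads m n \<rho> c D"
        using * k' by (auto simp: quads_def Suc_le_eq x)
    qed
    show "(\<lambda>(a, q, b, s). (gcd b s, a, q, b div gcd b s, s div gcd b s)) ` quads m n \<rho> c D
        \<subseteq> (SIGMA k:Ks. prim_quads m n (\<rho> / real k) c (D div k))"
    proof (rule image_subsetI)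
      fix x assume x: "x \<in> quads m n \<rho> c D"
      obtain a q b s where abcd: "x = (a, q, b, s)" by (cases x)
      with x have *: "1 \<le> a" "a \<le> q" "q \<le> n" "coprime a q" "coprime q m" "1 \<le> s" "coprime s m"
         "real s \<le> \<rho> * real n" "b * q = a * s + D" "real D * (real n)\<^sup>2 < c * real q * real s"
        by (auto simp: quads_def)
      define k where "k = gcd b s"
      have k: "k > 0" using *(6) by (simp add: k_def)
      obtain b' s' where bs: "b = k * b'" "s = k * s'" "coprime b' s'"
        using gcd_coprime_exists[of b s] k unfolding k_def by (auto simp: mult.commute)
      have "k dvd b * q" "k dvd a * s" unfolding bs by auto
      hence "k dvd D" unfolding *(9) by (simp add: dvd_add_right_iff)
      then obtain D' where D': "D = k * D'" by auto
      have "k * (b' * q) = k * (a * s' + D')" using *(9) unfolding bs D' by (simp add: algebra_simps)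
      hence "b' * q = a * s' + D'" using k by simp
      moreover have "coprime k m" "coprime s' m" using *(7) unfolding bs by auto
      moreover have "real s' \<le> \<rho> / real k * real n" using *(8) k unfolding bs by (simp add: field_simps)
      moreover have "real D' * (real n)\<^sup>2 < c * real q * real s'"
      proof -
        have "real k * (real D' * (real n)\<^sup>2) < real k * (c * real q * real s')"
          using *(10) unfolding D' bs by (simp add: mult_ac)
        thus ?thesis using k by simp
      qed
      moreover have "1 \<le> s'" using *(6) unfolding bs by (cases s') auto
      ultimately have "(a, q, b', s') \<in> prim_quads m n (\<rho> / real k) c D'" "k \<in> Ks"
        using * bs D' by (auto simp: prim_quads_def quads_def Ks_def)
      moreover have "D div k = D'" "b div k = b'" "s div k = s'" using D' bs k by auto
      ultimately show "(case x of (a, q, b, s) \<Rightarrow> (gcd b s, a, q, b div gcd b s, s div gcd b s))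
          \<in> (SIGMA k:Ks. prim_quads m n (\<rho> / real k) c (D div k))"
        by (simp add: abcd k_def[symmetric])
    qed
  qed
  hence "card (quads m n \<rho> c D) = card (SIGMA k:Ks. prim_quads m n (\<rho> / real k) c (D div k))"
    by (simp add: bij_betw_same_card)
  also have "\<dots> = (\<Sum>k\<in>Ks. card (prim_quads m n (\<rho> / real k) c (D div k)))"
    using fin by (subst card_SigmaI) auto
  finally show ?thesis by (simp add: Ks_def)
qed

text \<open>Up to the factor \<open>D\<close>, the proportion of \<open>quads\<close> in which the second fraction is reduced as well: it is
  \<open>D\<close> times the product of \<open>1 - 1 / p\<close> over the primes \<open>p\<close> dividing \<open>D\<close> but not \<open>m\<close>.\<close>

definition weight :: "nat \<Rightarrow> nat \<Rightarrow> real" where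
  "weight m D = real (totient D) * (real (gcd D m) / real (totient (gcd D m)))"

text \<open>Primes common to D and m are moved into D1 one at a time.\<close>

lemma split_off_coprime_part:
  fixes D m :: nat
  assumes "D > 0"
  shows "\<exists>D1 D2. D = D1 * D2 \<and> coprime D2 m \<and> (\<forall>p\<in>prime_factors D1. p dvd m)"
  using assms
proof (induction D rule: less_induct)
  case (less D)
  show ?case
  proof (cases "coprime D m")
    case True
    thus ?thesis by (intro exI[of _ 1] exI[of _ D]) auto
  next
    case False
    then obtain p where p: "prime p" "p dvd D" "p dvd m"
      by (metis coprime_iff_gcd_eq_1 gcd_greatest_iff gcd_nat.bounded_iff prime_factor_nat dvd_refl)
    then obtain D' where D': "D = p * D'" by auto
    have "D' > 0" "D' < D" using less.prems D' prime_gt_1_nat[OF p(1)] by auto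
    then obtain D1 D2 where *: "D' = D1 * D2" "coprime D2 m" "\<forall>p\<in>prime_factors D1. p dvd m"
      using less.IH by blast
    have "D1 \<noteq> 0" using * \<open>D' > 0\<close> by auto
    hence "\<forall>r\<in>prime_factors (p * D1). r dvd m"
      using * p by (auto simp: prime_factors_product prime_factorization_prime)
    thus ?thesis using * D' by (intro exI[of _ "p * D1"] exI[of _ D2]) auto
  qed
qed

text \<open>D1 and gcd D1 m have the same prime factors, hence the same ratio of totient to number,
  so the gcd factor in \<open>weight\<close> turns \<open>totient D1\<close> into D1.\<close>

lemma weight_split:
  assumes "D1 > 0" "D2 > 0" "m > 0" "coprime D2 m" "\<forall>p\<in>prime_factors D1. p dvd m"
  shows "weight m (D1 * D2) = real D1 * real (totient D2)"
proof -
  have cop: "coprime D1 D2"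
    using assms coprime_iff_no_common_prime[of D1 D2]
    by (metis coprime_commute coprime_common_divisor in_prime_factors_imp_prime not_prime_unit)
  define g where "g = gcd D1 m"
  have gcd: "gcd (D1 * D2) m = g"
    unfolding g_def using assms(4)
    by (subst mult.commute) (simp add: gcd_mult_left_left_cancel coprime_commute)
  have "prime_factors g = prime_factors D1"
    using assms by (auto simp: g_def in_prime_factors_iff)
  hence "real (totient D1) / real D1 = real (totient g) / real g"
    using assms by (simp add: totient_formula2 g_def)
  moreover have "g > 0" using assms by (simp add: g_def)
  ultimately have "real (totient D1) * (real g / real (totient g)) = real D1"
    using assms by (simp add: field_simps)
  thus ?thesis
    unfolding weight_def gcd using totient_mult_coprime[OF cop]
    by (metis mult.assoc mult.commute of_nat_mult)
qed

text \<open>The k concerned are the divisors of D2, the part of D coprime to m. With D1 factored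
  out, what remains is the sum of the totient over the divisors of D2. This identity is what makes
  \<open>weight\<close> solve the recursion coming from \<open>card_quads_decomp\<close>.\<close>

lemma sum_weight:
  assumes "D > 0" "m > 0"
  shows "(\<Sum>k | k dvd D \<and> coprime k m. weight m (D div k)) = real D"
proof -
  obtain D1 D2 where D: "D = D1 * D2" "coprime D2 m" "\<forall>p\<in>prime_factors D1. p dvd m"
    using split_off_coprime_part[OF assms(1)] by blast
  have pos: "D1 > 0" "D2 > 0" using D assms by (auto intro!: Nat.gr0I)
  have set: "{k. k dvd D \<and> coprime k m} = {k. k dvd D2}"
  proof (intro equalityI subsetI)
    fix k assume k: "k \<in> {k. k dvd D \<and> coprime k m}"
    have "coprime k D1"
      using pos k D(3) coprime_iff_no_common_prime[of D1 k]
      by (metis coprime_common_divisor in_prime_factors_imp_prime mem_Collect_eq not_prime_unit)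
    thus "k \<in> {k. k dvd D2}" using k D(1) by (simp add: coprime_dvd_mult_right_iff)
  next
    fix k assume "k \<in> {k. k dvd D2}"
    thus "k \<in> {k. k dvd D \<and> coprime k m}" using D by (auto intro: coprime_divisors)
  qed
  have "(\<Sum>k | k dvd D2. weight m (D div k)) = (\<Sum>k | k dvd D2. real D1 * real (totient (D2 div k)))"
  proof (intro sum.cong refl)
    fix k assume k: "k \<in> {k. k dvd D2}"
    then obtain l where l: "D2 = k * l" by auto
    have lk: "k > 0" "l > 0" "coprime l m" using l pos D(2) by (auto intro!: Nat.gr0I)
    have "D div k = D1 * l" "D2 div k = l" using D(1) l lk by auto
    thus "weight m (D div k) = real D1 * real (totient (D2 div k))"
      using weight_split[of D1 l m] pos lk assms D(3) by simp
  qed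
  also have "\<dots> = real D1 * real (\<Sum>k | k dvd D2. totient (D2 div k))"
    by (simp add: sum_distrib_left)
  also have "(\<Sum>k | k dvd D2. totient (D2 div k)) = (\<Sum>d | d dvd D2. totient d)"
    using pos by (intro sum.reindex_bij_witness[of _ "(div) D2" "(div) D2"]) (auto elim: dvdE)
  also have "\<dots> = D2" by (rule totient_divisor_sum)
  finally show ?thesis using set D(1) by simp
qed

text \<open>Terms with k > 1 have the smaller determinant D / k and the range \<rho> / k, hence the
  generalisation over \<rho>. Since (D / k) / (c \<rho> / k) = D / (c \<rho>), all terms share one
  value of \<open>Phi\<close>, and \<open>sum_weight\<close> solves for the term k = 1.\<close>

lemma card_prim_quads_asymp:
  assumes "m > 0" "D > 0" "c > 0" "\<rho> > 0"
  shows "(\<lambda>n. real (card (prim_quads m n \<rho> c D)) / (real n)\<^sup>2)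
     \<longlonglongrightarrow> real (totient m) / real m * C m * \<rho> * (weight m D / real D) * Phi (real D / (c * \<rho>))"
  using assms(2,4)
proof (induction D arbitrary: \<rho> rule: less_induct)
  case (less D)
  define \<kappa> where "\<kappa> = real (totient m) / real m * C m * \<rho> * Phi (real D / (c * \<rho>))"
  define Ks where "Ks = {k. k dvd D \<and> coprime k m}"
  have fin: "finite Ks" using less.prems by (simp add: Ks_def)
  have one: "1 \<in> Ks" by (simp add: Ks_def)
  have lim: "(\<lambda>n. real (card (prim_quads m n (\<rho> / real k) c (D div k))) / (real n)\<^sup>2)
       \<longlonglongrightarrow> \<kappa> * (weight m (D div k) / real D)" if k: "k \<in> Ks - {1}" for k
  proof -
    obtain l where l: "D = k * l" using k by (auto simp: Ks_def)
    have pos: "k > 0" "l > 0" using l less.prems by (auto intro!: Nat.gr0I)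
    have "k > 1" using k pos by auto
    hence "l < D" using l pos by simp
    hence "(\<lambda>n. real (card (prim_quads m n (\<rho> / real k) c l)) / (real n)\<^sup>2)
     \<longlonglongrightarrow> real (totient m) / real m * C m * (\<rho> / real k) * (weight m l / real l) * Phi (real l / (c * (\<rho> / real k)))"
      using less.prems pos by (intro less.IH) auto
    also have "real l / (c * (\<rho> / real k)) = real D / (c * \<rho>)"
      using pos assms less.prems by (simp add: l field_simps)
    also have "real (totient m) / real m * C m * (\<rho> / real k) * (weight m l / real l) * Phi (real D / (c * \<rho>))
        = \<kappa> * (weight m l / real D)"
      using pos by (simp add: \<kappa>_def l field_simps)
    finally show ?thesis using pos l by simp
  qed
  have eq: "real (card (quads m n \<rho> c D)) / (real n)\<^sup>2
        - (\<Sum>k\<in>Ks - {1}. real (card (prim_quads m n (\<rho> / real k) c (D div k))) / (real n)\<^sup>2)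
      = real (card (prim_quads m n \<rho> c D)) / (real n)\<^sup>2" for n
    unfolding card_quads_decomp[OF less.prems(1)] Ks_def[symmetric] sum.remove[OF fin one]
    by (simp add: sum_divide_distrib add_divide_distrib)
  have "(\<lambda>n. real (card (quads m n \<rho> c D)) / (real n)\<^sup>2
        - (\<Sum>k\<in>Ks - {1}. real (card (prim_quads m n (\<rho> / real k) c (D div k))) / (real n)\<^sup>2))
      \<longlonglongrightarrow> \<kappa> - (\<Sum>k\<in>Ks - {1}. \<kappa> * (weight m (D div k) / real D))"
    unfolding \<kappa>_def using assms less.prems lim[unfolded \<kappa>_def]
    by (intro tendsto_diff tendsto_sum card_quads_asymp) auto
  moreover have "\<kappa> - (\<Sum>k\<in>Ks - {1}. \<kappa> * (weight m (D div k) / real D)) = \<kappa> * (weight m D / real D)"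
  proof -
    have "weight m D + (\<Sum>k\<in>Ks - {1}. weight m (D div k)) = real D"
      using sum_weight[OF less.prems(1) assms(1)] sum.remove[OF fin one, of "\<lambda>k. weight m (D div k)"]
      by (simp add: Ks_def)
    hence "(\<Sum>k\<in>Ks - {1}. weight m (D div k)) = real D - weight m D" by simp
    hence "(\<Sum>k\<in>Ks - {1}. \<kappa> * (weight m (D div k) / real D)) = \<kappa> * ((real D - weight m D) / real D)"
      by (simp flip: sum_distrib_left sum_divide_distrib)
    thus ?thesis using less.prems by (simp add: field_simps)
  qed
  ultimately show ?case unfolding eq by (simp add: \<kappa>_def mult_ac)
qed

section \<open>From initial intervals to all bounded intervals\<close>

text \<open>Continuity of G leaves no mass at points in the limit, so open and closed ends do not
  matter; reflection handles the negative axis. Additivity is assumed only eventually and inside a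
  fixed window, because pair counts modulo 1 satisfy it only once N exceeds the length of the
  window.\<close>

lemma convergent_on_bounded_intervals:
  fixes \<mu> :: "nat \<Rightarrow> real set \<Rightarrow> real" and G :: "real \<Rightarrow> real"
  assumes nonneg: "\<And>n I. \<mu> n I \<ge> 0"
    and sym: "\<And>n I. \<mu> n (uminus ` I) = \<mu> n I"
    and add: "\<And>L. \<forall>\<^sub>F n in sequentially. \<forall>I J. I \<inter> J = {} \<longrightarrow> I \<union> J \<subseteq> {-L..L} \<longrightarrow>
                 \<mu> n (I \<union> J) = \<mu> n I + \<mu> n J"
    and lim: "\<And>x. x \<ge> 0 \<Longrightarrow> (\<lambda>n. \<mu> n {0..x}) \<longlonglongrightarrow> G x"
    and G0: "G 0 = 0"
    and cont: "\<And>x. x > 0 \<Longrightarrow> (G \<longlongrightarrow> G x) (at_left x)"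
    and I: "is_interval I" "bounded I"
  shows "convergent (\<lambda>n. \<mu> n I)"
proof -
  have ev_add: "\<forall>\<^sub>F n in sequentially. \<mu> n (A \<union> B) = \<mu> n A + \<mu> n B"
    if "A \<inter> B = {}" "A \<union> B \<subseteq> {-L..L}" for A B L
    using add[of L] by eventually_elim (use that in blast)
  have atom_pos: "(\<lambda>n. \<mu> n {a}) \<longlonglongrightarrow> 0" if "a \<ge> 0" for a
  proof (cases "a = 0")
    case True
    thus ?thesis using lim[of 0] G0 by simp
  next
    case False
    hence a: "a > 0" using that by simp
    show ?thesis
    proof (rule LIMSEQ_I)
      fix e :: real assume e: "e > 0"
      \<comment> \<open>The mass at a is at most that of (y, a], which tends to G a - G y and is
        small for y close to a.\<close>
      have "\<forall>\<^sub>F y in at_left a. \<bar>G y - G a\<bar> < e / 2"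
        using tendstoD[OF cont[OF a], of "e / 2"] e by (simp add: dist_real_def)
      moreover have "\<forall>\<^sub>F y in at_left a. y \<in> {0<..<a}" using a by (rule eventually_at_left_real)
      ultimately have "\<forall>\<^sub>F y in at_left a. \<bar>G y - G a\<bar> < e / 2 \<and> y \<in> {0<..<a}"
        by eventually_elim auto
      then obtain y where y: "\<bar>G y - G a\<bar> < e / 2" "0 < y" "y < a"
        using eventually_happens by (metis (no_types, lifting) greaterThanLessThan_iff trivial_limit_at_left_real)
      have "(\<lambda>n. \<mu> n {0..a} - \<mu> n {0..y}) \<longlonglongrightarrow> G a - G y"
        using a y by (intro tendsto_diff lim) auto
      hence "\<forall>\<^sub>F n in sequentially. \<mu> n {0..a} - \<mu> n {0..y} < e"
        using y e by (intro order_tendstoD(2)[where y = "G a - G y"]) linarith+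
      moreover have "\<forall>\<^sub>F n in sequentially. \<mu> n ({0..y} \<union> {y<..a}) = \<mu> n {0..y} + \<mu> n {y<..a}"
        using y by (intro ev_add[where L = a]) auto
      moreover have "\<forall>\<^sub>F n in sequentially. \<mu> n ({y<..<a} \<union> {a}) = \<mu> n {y<..<a} + \<mu> n {a}"
        using y by (intro ev_add[where L = a]) auto
      ultimately have "\<forall>\<^sub>F n in sequentially. norm (\<mu> n {a} - 0) < e"
      proof eventually_elim
        case (elim n)
        have "{0..y} \<union> {y<..a} = {0..a}" "{y<..<a} \<union> {a} = {y<..a}" using y by auto
        thus ?case using elim nonneg[of n "{y<..<a}"] nonneg[of n "{a}"] by simp
      qed
      thus "\<exists>no. \<forall>n\<ge>no. norm (\<mu> n {a} - 0) < e" by (simp add: eventually_sequentially)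
    qed
  qed
  have atom: "(\<lambda>n. \<mu> n {a}) \<longlonglongrightarrow> 0" for a
  proof (cases "a \<ge> 0")
    case False
    have "\<mu> n {a} = \<mu> n {-a}" for n using sym[of n "{a}"] by simp
    thus ?thesis using atom_pos[of "-a"] False by simp
  qed (use atom_pos in auto)
  have pos: "convergent (\<lambda>n. \<mu> n {a..b})" if ab: "0 \<le> a" "a \<le> b" for a b
  proof -
    have "(\<lambda>n. \<mu> n {0..b} - \<mu> n {0..a} + \<mu> n {a}) \<longlonglongrightarrow> G b - G a + 0"
      using ab by (intro tendsto_add tendsto_diff lim atom) auto
    moreover have "\<forall>\<^sub>F n in sequentially. \<mu> n {0..b} - \<mu> n {0..a} + \<mu> n {a} = \<mu> n {a..b}"
    proof -
      have "\<forall>\<^sub>F n in sequentially. \<mu> n ({0..<a} \<union> {a..b}) = \<mu> n {0..<a} + \<mu> n {a..b}"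
        using ab by (intro ev_add[where L = b]) auto
      moreover have "\<forall>\<^sub>F n in sequentially. \<mu> n ({0..<a} \<union> {a}) = \<mu> n {0..<a} + \<mu> n {a}"
        using ab by (intro ev_add[where L = b]) auto
      moreover have "{0..<a} \<union> {a..b} = {0..b}" "{0..<a} \<union> {a} = {0..a}" using ab by auto
      ultimately show ?thesis by (auto elim: eventually_elim2)
    qed
    ultimately have "(\<lambda>n. \<mu> n {a..b}) \<longlonglongrightarrow> G b - G a + 0" by (rule Lim_transform_eventually)
    thus ?thesis by (rule convergentI)
  qed
  have neg: "\<mu> n {a..b} = \<mu> n {-b..-a}" for n a b
    using sym[of n "{a..b}"] by simp
  have closed: "convergent (\<lambda>n. \<mu> n {a..b})" if ab: "a \<le> b" for a b
  proof -
    consider "0 \<le> a" | "b \<le> 0" | "a < 0" "0 < b" by linarith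
    thus ?thesis
    proof cases
      case 1
      thus ?thesis using pos ab by blast
    next
      case 2
      thus ?thesis using pos[of "-b" "-a"] ab by (simp add: neg[of _ a b])
    next
      case 3
      \<comment> \<open>The point 0 lies in both halves, so its mass is subtracted once.\<close>
      have "(\<lambda>n. \<mu> n {0..-a} - \<mu> n {0} + \<mu> n {0..b}) \<longlonglongrightarrow> G (-a) - 0 + G b"
        using 3 by (intro tendsto_add tendsto_diff lim atom) auto
      moreover have "\<forall>\<^sub>F n in sequentially. \<mu> n {0..-a} - \<mu> n {0} + \<mu> n {0..b} = \<mu> n {a..b}"
      proof -
        have "\<forall>\<^sub>F n in sequentially. \<mu> n ({a..<0} \<union> {0}) = \<mu> n {a..<0} + \<mu> n {0}"
          using 3 by (intro ev_add[where L = "max (-a) b"]) auto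
        moreover have "\<forall>\<^sub>F n in sequentially. \<mu> n ({a..<0} \<union> {0..b}) = \<mu> n {a..<0} + \<mu> n {0..b}"
          using 3 by (intro ev_add[where L = "max (-a) b"]) auto
        moreover have "{a..<0} \<union> {0} = {a..0}" "{a..<0} \<union> {0..b} = {a..b}" using 3 by auto
        ultimately show ?thesis using neg[of _ a 0] by (auto elim: eventually_elim2)
      qed
      ultimately have "(\<lambda>n. \<mu> n {a..b}) \<longlonglongrightarrow> G (-a) - 0 + G b" by (rule Lim_transform_eventually)
      thus ?thesis by (rule convergentI)
    qed
  qed
  show ?thesis
  proof (cases "I = {}")
    case True
    have "\<forall>\<^sub>F n in sequentially. \<mu> n ({} \<union> {}) = \<mu> n {} + \<mu> n {}"
      by (intro ev_add[where L = 0]) auto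
    hence "(\<lambda>n. \<mu> n I) \<longlonglongrightarrow> 0"
      unfolding True by (intro tendsto_eventually) (auto elim: eventually_mono)
    thus ?thesis by (rule convergentI)
  next
    case False
    define a b where "a = Inf I" and "b = Sup I"
    have bdd: "bdd_above I" "bdd_below I"
      using I(2) by (auto simp: bounded_imp_bdd_above bounded_imp_bdd_below)
    have sub: "I \<subseteq> {a..b}"
      using bdd by (auto simp: a_def b_def intro: cInf_lower cSup_upper)
    have ab: "a \<le> b" using False sub by force
    have "{a<..<b} \<subseteq> I"
    proof
      fix x assume x: "x \<in> {a<..<b}"
      obtain y where y: "y \<in> I" "y < x" using x False bdd cInf_less_iff[of I x] by (auto simp: a_def)
      obtain z where z: "z \<in> I" "x < z" using x False bdd less_cSup_iff[of I x] by (auto simp: b_def)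
      show "x \<in> I" using I(1) y z unfolding is_interval_1 by (meson less_imp_le)
    qed
    \<comment> \<open>So I differs from a closed interval by at most two points, whose mass tends to
      0.\<close>
    hence diff: "{a..b} - I \<subseteq> {a, b}" by force
    define L where "L = max \<bar>a\<bar> \<bar>b\<bar>"
    have L: "{a..b} \<subseteq> {-L..L}" by (auto simp: L_def)
    have "(\<lambda>n. \<mu> n ({a..b} - I)) \<longlonglongrightarrow> 0"
    proof (rule tendsto_sandwich[where f = "\<lambda>_. 0" and h = "\<lambda>n. \<mu> n {a} + \<mu> n {b}"])
      have "\<forall>\<^sub>F n in sequentially. \<mu> n ({a..b} - I) \<le> \<mu> n {a, b}"
      proof -
        have "\<forall>\<^sub>F n in sequentially. \<mu> n (({a..b} - I) \<union> ({a, b} - ({a..b} - I)))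
             = \<mu> n ({a..b} - I) + \<mu> n ({a, b} - ({a..b} - I))"
          using ab L by (intro ev_add[where L = L]) auto
        moreover have "({a..b} - I) \<union> ({a, b} - ({a..b} - I)) = {a, b}" using diff by blast
        ultimately show ?thesis using nonneg by (auto elim!: eventually_mono)
      qed
      moreover have "\<forall>\<^sub>F n in sequentially. \<mu> n {a, b} \<le> \<mu> n {a} + \<mu> n {b}"
      proof (cases "a = b")
        case True
        thus ?thesis using nonneg by simp
      next
        case False
        hence "\<forall>\<^sub>F n in sequentially. \<mu> n ({a} \<union> {b}) = \<mu> n {a} + \<mu> n {b}"
          using ab L by (intro ev_add[where L = L]) auto
        moreover have "{a} \<union> {b} = {a, b}" by auto
        ultimately show ?thesis by (auto elim!: eventually_mono)
      qed
      ultimately show "\<forall>\<^sub>F n in sequentially. \<mu> n ({a..b} - I) \<le> \<mu> n {a} + \<mu> n {b}"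
        by eventually_elim linarith
      show "(\<lambda>n. \<mu> n {a} + \<mu> n {b}) \<longlonglongrightarrow> 0"
        using tendsto_add[OF atom[of a] atom[of b]] by simp
    qed (use nonneg in auto)
    moreover obtain l where "(\<lambda>n. \<mu> n {a..b}) \<longlonglongrightarrow> l"
      using closed[OF ab] by (auto simp: convergent_def)
    ultimately have "(\<lambda>n. \<mu> n {a..b} - \<mu> n ({a..b} - I)) \<longlonglongrightarrow> l - 0" by (intro tendsto_diff)
    moreover have "\<forall>\<^sub>F n in sequentially. \<mu> n {a..b} - \<mu> n ({a..b} - I) = \<mu> n I"
    proof -
      have "\<forall>\<^sub>F n in sequentially. \<mu> n (I \<union> ({a..b} - I)) = \<mu> n I + \<mu> n ({a..b} - I)"
        using sub L by (intro ev_add[where L = L]) auto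
      moreover have "I \<union> ({a..b} - I) = {a..b}" using sub by auto
      ultimately show ?thesis by (auto elim!: eventually_mono)
    qed
    ultimately have "(\<lambda>n. \<mu> n I) \<longlonglongrightarrow> l - 0" by (rule Lim_transform_eventually)
    thus ?thesis by (rule convergentI)
  qed
qed

section \<open>Symmetry, additivity and monotonicity of \<open>pair_corr\<close>\<close>

lemma pair_corr_nonneg: "pair_corr F I \<ge> 0"
  by (simp add: pair_corr_def)

text \<open>Exchanging x and y negates both t and k.\<close>

lemma pair_corr_uminus: "pair_corr F (uminus ` I) = pair_corr F I"
proof -
  define E where "E = (\<lambda>I. {(x, y). x \<in> F \<and> y \<in> F \<and> y \<noteq> x \<and>
       (\<exists>t\<in>I. \<exists>k::int. y - x = 1 / real (card F) * t + of_int k)})"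
  have sub: "prod.swap ` E I \<subseteq> E (uminus ` I)" for I
  proof (rule image_subsetI)
    fix z assume "z \<in> E I"
    then obtain x y t k where *: "z = (x, y)" "x \<in> F" "y \<in> F" "y \<noteq> x" "t \<in> I" "y - x = 1 / real (card F) * t + of_int k"
      by (auto simp: E_def)
    hence "x - y = 1 / real (card F) * (-t) + of_int (-k)" by simp
    moreover have "-t \<in> uminus ` I" using * by simp
    ultimately have "\<exists>t\<in>uminus ` I. \<exists>k::int. x - y = 1 / real (card F) * t + of_int k" by blast
    thus "prod.swap z \<in> E (uminus ` I)" using *(1-4) unfolding E_def by simp
  qed
  have "E (uminus ` I) = prod.swap ` E I"
  proof
    have "prod.swap ` E (uminus ` I) \<subseteq> E (uminus ` uminus ` I)" by (rule sub)
    hence "prod.swap ` E (uminus ` I) \<subseteq> E I" by (simp add: image_image)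
    hence "prod.swap ` prod.swap ` E (uminus ` I) \<subseteq> prod.swap ` E I" by (rule image_mono)
    thus "E (uminus ` I) \<subseteq> prod.swap ` E I" by (simp add: image_image)
  qed (rule sub)
  hence "card (E (uminus ` I)) = card (E I)" by (simp add: card_image)
  thus ?thesis by (simp add: pair_corr_def E_def)
qed

text \<open>Let N be the cardinality of F. If t in I and t' in J represent the same difference
  modulo 1, then t - t' is a multiple of N; as |t - t'| \<le> 2 L < N it is 0, against
  disjointness.\<close>

lemma pair_corr_Un:
  assumes "finite F" "2 * L < real (card F)" "I \<inter> J = {}" "I \<union> J \<subseteq> {-L..L}"
  shows "pair_corr F (I \<union> J) = pair_corr F I + pair_corr F J"
proof -
  define E where "E = (\<lambda>I. {(x, y). x \<in> F \<and> y \<in> F \<and> y \<noteq> x \<and>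
       (\<exists>t\<in>I. \<exists>k::int. y - x = 1 / real (card F) * t + of_int k)})"
  have fin: "finite (E I)" for I
    by (rule finite_subset[of _ "F \<times> F"]) (use assms(1) in \<open>auto simp: E_def\<close>)
  have "E I \<inter> E J = {}"
  proof (rule ccontr)
    assume "E I \<inter> E J \<noteq> {}"
    then obtain x y t k t' k' where *: "t \<in> I" "t' \<in> J"
      "y - x = 1 / real (card F) * t + of_int k" "y - x = 1 / real (card F) * t' + of_int k'" "x \<in> F"
      by (auto simp: E_def) blast
    have N: "real (card F) > 0" using *(5) assms(1) by (auto simp: card_gt_0_iff)
    have "t - t' = real (card F) * of_int (k' - k)"
      using *(3,4) N by (simp add: field_simps)
    moreover have "\<bar>t - t'\<bar> < real (card F)"
      using assms(2,4) *(1,2) by (auto simp: subset_iff abs_if) (smt (verit) UnI1 UnI2)+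
    ultimately have "real (card F) * \<bar>of_int (k' - k)\<bar> < real (card F) * 1"
      using N by (simp add: abs_mult)
    hence "\<bar>k' - k\<bar> < 1" using N by (simp only: mult_less_cancel_left_pos)
    hence "t = t'" using \<open>t - t' = _\<close> by simp
    thus False using * assms(3) by auto
  qed
  moreover have "E (I \<union> J) = E I \<union> E J" by (auto simp: E_def)
  ultimately have "card (E (I \<union> J)) = card (E I) + card (E J)"
    using fin by (simp add: card_Un_disjoint)
  thus ?thesis by (simp add: pair_corr_def E_def algebra_simps)
qed

lemma pair_corr_mono:
  assumes "finite F" "I \<subseteq> J"
  shows "pair_corr F I \<le> pair_corr F J"
  unfolding pair_corr_def
proof (intro mult_left_mono of_nat_mono card_mono)
  show "finite {(x, y). x \<in> F \<and> y \<in> F \<and> y \<noteq> x \<and>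
       (\<exists>t\<in>J. \<exists>k::int. y - x = 1 / real (card F) * t + of_int k)}"
    by (rule finite_subset[of _ "F \<times> F"]) (use assms(1) in auto)
qed (use assms(2) in auto)

section \<open>Pair correlation of the Farey fractions\<close>

lemma reduced_fraction_eq:
  fixes a q b s :: nat
  assumes "q > 0" "s > 0" "coprime a q" "coprime b s" "real a / real q = real b / real s"
  shows "a = b \<and> q = s"
proof -
  have "real a * real s = real b * real q" using assms by (simp add: field_simps)
  hence "a * s = b * q" by (metis of_nat_eq_iff of_nat_mult)
  thus ?thesis using assms(3,4) coprime_crossproduct_nat[of a q b s]
    by (auto simp: mult.commute coprime_commute)
qed

lemma farey_coprimeI:
  "0 < a \<Longrightarrow> a \<le> q \<Longrightarrow> q \<le> n \<Longrightarrow> coprime a q \<Longrightarrow> coprime q m \<Longrightarrow>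
    real a / real q \<in> farey_coprime m n"
  unfolding farey_coprime_def by blast

lemma farey_coprime_eq_image:
  "farey_coprime m n = (\<lambda>(q, a). real a / real q) ` (SIGMA q:{q\<in>{1..n}. coprime q m}. totatives q)"
  by (force simp: farey_coprime_def totatives_def image_iff)

lemma finite_farey_coprime: "finite (farey_coprime m n)"
  unfolding farey_coprime_eq_image by (intro finite_imageI finite_SigmaI) auto

lemma farey_coprime_bounds: "x \<in> farey_coprime m n \<Longrightarrow> 0 < x \<and> x \<le> 1"
  by (auto simp: farey_coprime_def)

lemma card_farey_coprime:
  "card (farey_coprime m n) = (\<Sum>q\<in>{q\<in>{1..n}. coprime q m}. totient q)"
proof -
  have "inj_on (\<lambda>(q, a). real a / real q) (SIGMA q:{q\<in>{1..n}. coprime q m}. totatives q)"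
  proof (rule inj_onI, clarify)
    fix q a s b assume "q \<in> {1..n}" "s \<in> {1..n}" "a \<in> totatives q" "b \<in> totatives s"
      "real a / real q = real b / real s"
    thus "q = s \<and> a = b" using reduced_fraction_eq[of q s a b] by (auto simp: totatives_def)
  qed
  hence "card (farey_coprime m n) = card (SIGMA q:{q\<in>{1..n}. coprime q m}. totatives q)"
    unfolding farey_coprime_eq_image by (rule card_image)
  also have "\<dots> = (\<Sum>q\<in>{q\<in>{1..n}. coprime q m}. totient q)"
    by (subst card_SigmaI) (auto simp: totient_def)
  finally show ?thesis .
qed

lemma card_farey_coprime_pos: "n > 0 \<Longrightarrow> card (farey_coprime m n) > 0"
proof -
  assume "n > 0"
  hence "real 1 / real 1 \<in> farey_coprime m n" by (intro farey_coprimeI) auto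
  thus ?thesis using finite_farey_coprime card_gt_0_iff by blast
qed

text \<open>For q coprime to m, \<open>totient q\<close> is q times \<open>dens m q\<close>, so this
  is the weighted Riemann sum with h t = t, whose integral is the factor 1 / 2.\<close>

lemma card_farey_coprime_asymp:
  assumes "m > 0"
  shows "(\<lambda>n. real (card (farey_coprime m n)) / (real n)\<^sup>2) \<longlonglongrightarrow> C m / 2"
proof -
  have "(\<lambda>n. (\<Sum>q\<in>{1..n}. dens m q * (real q / real n)) / real n) \<longlonglongrightarrow> C m * integral {0..1} (\<lambda>t. t)"
    using assms by (intro weighted_riemann_sum mean_dens dens_bounds) (auto intro: continuous_intros)
  moreover have "(\<Sum>q\<in>{1..n}. dens m q * (real q / real n)) / real n
      = real (card (farey_coprime m n)) / (real n)\<^sup>2" for n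
  proof -
    have "real (card (farey_coprime m n)) = (\<Sum>q\<in>{q\<in>{1..n}. coprime q m}. real (totient q))"
      by (simp add: card_farey_coprime)
    also have "\<dots> = (\<Sum>q\<in>{1..n}. if coprime q m then real (totient q) else 0)"
      by (subst sum.inter_filter) auto
    also have "\<dots> = (\<Sum>q\<in>{1..n}. dens m q * real q)"
      by (intro sum.cong) (auto simp: dens_def)
    finally show ?thesis by (simp add: sum_divide_distrib power2_eq_square)
  qed
  moreover have "integral {0..1} (\<lambda>t::real. t) = 1 / 2"
    using ident_has_integral[of 0 "1::real"] by (simp add: integral_unique)
  ultimately show ?thesis by simp
qed

lemma incseq_farey_coprime: "incseq (farey_coprime m)"
  unfolding incseq_def farey_coprime_def by (auto intro: order_trans)

text \<open>Only determinants \<open>D < c\<close> can occur, because \<open>q s \<le> n\<^sup>2\<close>.\<close>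

definition near :: "nat \<Rightarrow> nat \<Rightarrow> real \<Rightarrow> (nat \<times> nat \<times> nat \<times> nat) set" where
  "near m n c = (\<Union>D\<in>{1..nat \<lfloor>c\<rfloor>}. prim_quads m n 1 c D)"

lemma card_near: "card (near m n c) = (\<Sum>D\<in>{1..nat \<lfloor>c\<rfloor>}. card (prim_quads m n 1 c D))"
  unfolding near_def
proof (rule card_UN_disjoint)
  show "\<forall>D\<in>{1..nat \<lfloor>c\<rfloor>}. \<forall>D'\<in>{1..nat \<lfloor>c\<rfloor>}. D \<noteq> D' \<longrightarrow>
      prim_quads m n 1 c D \<inter> prim_quads m n 1 c D' = {}"
    by (auto simp: prim_quads_def quads_def)
qed auto

definition near_lim :: "nat \<Rightarrow> real \<Rightarrow> real" where
  "near_lim m c = real (totient m) / real m * C m *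
     (\<Sum>D\<in>{1..nat \<lfloor>c\<rfloor>}. weight m D / real D * Phi (real D / c))"

lemma card_near_asymp:
  assumes "m > 0" "c > 0"
  shows "(\<lambda>n. real (card (near m n c)) / (real n)\<^sup>2) \<longlonglongrightarrow> near_lim m c"
proof -
  have "(\<lambda>n. \<Sum>D\<in>{1..nat \<lfloor>c\<rfloor>}. real (card (prim_quads m n 1 c D)) / (real n)\<^sup>2)
     \<longlonglongrightarrow> (\<Sum>D\<in>{1..nat \<lfloor>c\<rfloor>}. real (totient m) / real m * C m * 1 * (weight m D / real D) * Phi (real D / (c * 1)))"
    using assms by (intro tendsto_sum card_prim_quads_asymp) auto
  thus ?thesis
    by (simp add: card_near near_lim_def sum_divide_distrib sum_distrib_left mult.assoc)
qed

lemma near_iff: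
  assumes "n > 0" "c > 0"
  shows "(a, q, b, s) \<in> near m n c \<longleftrightarrow> 1 \<le> a \<and> a \<le> q \<and> q \<le> n \<and> coprime a q \<and> coprime q m \<and>
     1 \<le> s \<and> s \<le> n \<and> coprime s m \<and> coprime b s \<and>
     0 < real b / real s - real a / real q \<and> real b / real s - real a / real q < c / (real n)\<^sup>2"
    (is "?L \<longleftrightarrow> ?R")
proof
  assume ?L
  then obtain D where D: "D \<ge> 1" "(a, q, b, s) \<in> prim_quads m n 1 c D" by (auto simp: near_def)
  hence *: "1 \<le> a" "a \<le> q" "q \<le> n" "coprime a q" "coprime q m" "1 \<le> s" "coprime s m" "coprime b s"
     "s \<le> n" "b * q = a * s + D" "real D * (real n)\<^sup>2 < c * real q * real s"
    by (auto simp: prim_quads_def quads_def)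
  have "real b * real q = real a * real s + real D"
    using *(10) by (metis of_nat_add of_nat_mult)
  hence "real b / real s - real a / real q = real D / (real q * real s)"
    using * by (simp add: field_simps)
  moreover have "real D / (real q * real s) < c / (real n)\<^sup>2"
    using * assms by (simp add: field_simps)
  moreover have "real D / (real q * real s) > 0" using * D by simp
  ultimately show ?R using * by simp
next
  assume R: ?R
  hence qs: "real q > 0" "real s > 0" by auto
  have "real a * real s < real b * real q" using R qs by (simp add: field_simps)
  hence less: "a * s < b * q" by (metis of_nat_less_iff of_nat_mult)
  define D where "D = b * q - a * s"
  have D: "D > 0" "b * q = a * s + D" using less by (auto simp: D_def)
  have "real b * real q = real a * real s + real D" using D(2) by (metis of_nat_add of_nat_mult)
  hence "real b / real s - real a / real q = real D / (real q * real s)"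
    using qs by (simp add: field_simps)
  hence "real D / (real q * real s) < c / (real n)\<^sup>2" using R by simp
  hence lt: "real D * (real n)\<^sup>2 < c * real q * real s"
    using qs assms by (simp add: field_simps)
  also have "\<dots> \<le> c * (real n)\<^sup>2"
    using R assms by (simp add: power2_eq_square mult.assoc mult_left_mono mult_mono)
  finally have "real D < c" using assms by simp
  hence "D \<le> nat \<lfloor>c\<rfloor>" by (simp add: le_nat_floor)
  moreover have "(a, q, b, s) \<in> prim_quads m n 1 c D"
    using R D lt by (auto simp: prim_quads_def quads_def)
  ultimately show ?L using D(1) by (auto simp: near_def)
qed

text \<open>Pairs are counted modulo 1, so \<open>y\<close> is replaced by the representative \<open>b / s\<close> of \<open>y + \<int>\<close> in
  \<open>(x, x + 1)\<close>.\<close>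

lemma card_close_pairs:
  fixes m n :: nat and c :: real
  assumes "n > 0" "c > 0" "c \<le> (real n)\<^sup>2"
  defines "F \<equiv> farey_coprime m n"
  defines "N \<equiv> real (card F)"
  shows "card {(x, y). x \<in> F \<and> y \<in> F \<and> y \<noteq> x \<and>
     (\<exists>t\<in>{0..<c * N / (real n)\<^sup>2}. \<exists>k::int. y - x = 1 / N * t + of_int k)} = card (near m n c)"
proof -
  define E where "E = {(x, y). x \<in> F \<and> y \<in> F \<and> y \<noteq> x \<and>
     (\<exists>t\<in>{0..<c * N / (real n)\<^sup>2}. \<exists>k::int. y - x = 1 / N * t + of_int k)}"
  define f where "f = (\<lambda>(a, q, b, s). (real a / real q, if b \<le> s then real b / real s else real b / real s - 1))"
  have N: "N > 0" using card_farey_coprime_pos[OF assms(1)] by (simp add: N_def F_def)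
  \<comment> \<open>A window of length at most 1, open on the left, contains at most one
    representative of each class modulo 1; injectivity of f rests on this.\<close>
  have c1: "c / (real n)\<^sup>2 \<le> 1" using assms by simp
  note near = near_iff[OF assms(1,2)]
  have inj: "inj_on f (near m n c)"
  proof (rule inj_onI)
    fix u v assume u: "u \<in> near m n c" and v: "v \<in> near m n c" and eq: "f u = f v"
    obtain a q b s where u': "u = (a, q, b, s)" by (cases u)
    obtain a' q' b' s' where v': "v = (a', q', b', s')" by (cases v)
    note u = u[unfolded u' near] and v = v[unfolded v' near]
    have x: "real a / real q = real a' / real q'" using eq by (simp add: f_def u' v')
    hence aq: "a = a' \<and> q = q'" using u v by (intro reduced_fraction_eq) auto
    have "(if b \<le> s then real b / real s else real b / real s - 1)
        = (if b' \<le> s' then real b' / real s' else real b' / real s' - 1)"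
      using eq by (simp add: f_def u' v')
    moreover have "0 < real b / real s - real a / real q" "real b / real s - real a / real q < 1"
      using u c1 by linarith+
    moreover have "0 < real b' / real s' - real a / real q" "real b' / real s' - real a / real q < 1"
      using v c1 x by linarith+
    ultimately have "real b / real s = real b' / real s'"
      by (auto split: if_splits)
    hence "b = b' \<and> s = s'" using u v by (intro reduced_fraction_eq) auto
    thus "u = v" using aq by (simp add: u' v')
  qed
  have "f ` near m n c = E"
  proof
    show "f ` near m n c \<subseteq> E"
    proof (rule image_subsetI)
      fix u assume u: "u \<in> near m n c"
      obtain a q b s where u': "u = (a, q, b, s)" by (cases u)
      note u = u[unfolded u' near]
      define x z where "x = real a / real q" and "z = real b / real s"
      have xF: "x \<in> F" unfolding F_def x_def using u by (intro farey_coprimeI) auto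
      have x01: "0 < x" "x \<le> 1" using farey_coprime_bounds xF unfolding F_def by auto
      have zx: "0 < z - x" "z - x < c / (real n)\<^sup>2" using u by (auto simp: x_def z_def)
      define t where "t = N * (z - x)"
      have tI: "t \<in> {0..<c * N / (real n)\<^sup>2}"
      proof -
        have "N * (z - x) < N * (c / (real n)\<^sup>2)" using zx N by (intro mult_strict_left_mono)
        thus ?thesis using zx N by (simp add: t_def mult.commute)
      qed
      have tz: "z - x = 1 / N * t" using N by (simp add: t_def)
      show "f u \<in> E"
      proof (cases "b \<le> s")
        case True
        have "b > 0" using zx x01 by (auto simp: z_def intro!: Nat.gr0I)
        hence "z \<in> F" unfolding F_def z_def using u True by (intro farey_coprimeI) auto
        moreover have "\<exists>t\<in>{0..<c * N / (real n)\<^sup>2}. \<exists>k::int. z - x = 1 / N * t + of_int k"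
          using tI tz by (intro bexI[of _ t] exI[of _ 0]) auto
        moreover have "z \<noteq> x" using zx by simp
        ultimately have "(x, z) \<in> E"
          using xF by (simp only: E_def mem_Collect_eq case_prod_conv simp_thms)
        thus ?thesis using True by (simp add: f_def u' x_def z_def)
      next
        case False
        have "z < 2" using zx x01 c1 by linarith
        hence "b - s \<le> s" "b - s > 0" using False u by (auto simp: z_def field_simps)
        moreover have "coprime (b - s) s" using u False by (simp add: coprime_iff_gcd_eq_1 gcd_diff1_nat)
        moreover have "z - 1 = real (b - s) / real s" using u False by (simp add: z_def of_nat_diff field_simps)
        ultimately have "z - 1 \<in> F" unfolding F_def using u by (simp only:) (intro farey_coprimeI, auto)
        moreover have "\<exists>t\<in>{0..<c * N / (real n)\<^sup>2}. \<exists>k::int. z - 1 - x = 1 / N * t + of_int k"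
          using tI tz by (intro bexI[of _ t] exI[of _ "-1"]) auto
        moreover have "z - 1 \<noteq> x" using zx c1 by linarith
        ultimately have "(x, z - 1) \<in> E"
          using xF by (simp only: E_def mem_Collect_eq case_prod_conv simp_thms)
        thus ?thesis using False by (simp add: f_def u' x_def z_def)
      qed
    qed
    show "E \<subseteq> f ` near m n c"
    proof
      fix u assume "u \<in> E"
      then obtain x y t k where u: "u = (x, y)" "x \<in> F" "y \<in> F" "y \<noteq> x"
        "0 \<le> t" "t < c * N / (real n)\<^sup>2" "y - x = 1 / N * t + of_int k"
        by (auto simp: E_def)
      obtain a q where x: "x = real a / real q" "0 < a" "a \<le> q" "q \<le> n" "coprime a q" "coprime q m"
        using u(2) by (auto simp: F_def farey_coprime_def)
      obtain b s where y: "y = real b / real s" "0 < b" "b \<le> s" "s \<le> n" "coprime b s" "coprime s m"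
        using u(3) by (auto simp: F_def farey_coprime_def)
      have bd: "0 < x" "x \<le> 1" "0 < y" "y \<le> 1" using farey_coprime_bounds u unfolding F_def by auto
      have t: "0 \<le> 1 / N * t" "1 / N * t < c / (real n)\<^sup>2"
        using u(5,6) N by (auto simp: field_simps)
      \<comment> \<open>Differences of the fractions lie in (-1, 1) and t / N in [0, 1), so either y
        is used as it stands or it is shifted by 1.\<close>
      have "real_of_int k < 1" "real_of_int k > -2" using u(7) t c1 bd by linarith+
      hence "k = 0 \<or> k = -1" by linarith
      thus "u \<in> f ` near m n c"
      proof
        assume k: "k = 0"
        \<comment> \<open>Here t = 0 would force y = x, so the difference is strictly positive, as
          \<open>near\<close> demands.\<close>
        hence "(a, q, b, s) \<in> near m n c" using u t x y unfolding near by auto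
        moreover have "f (a, q, b, s) = u" using y x u by (simp add: f_def)
        ultimately show ?thesis by (metis imageI)
      next
        assume k: "k = -1"
        have z: "real (b + s) / real s = y + 1" using y by (simp add: field_simps)
        have "coprime (b + s) s" using y by (simp add: coprime_iff_gcd_eq_1)
        moreover have "0 < real (b + s) / real s - x" "real (b + s) / real s - x < c / (real n)\<^sup>2"
          unfolding z using u(7) k t bd by auto
        ultimately have "(a, q, b + s, s) \<in> near m n c" using x y unfolding near by auto
        moreover have "f (a, q, b + s, s) = u"
        proof -
          have "\<not> b + s \<le> s" using y by simp
          thus ?thesis using z x u by (simp add: f_def del: of_nat_add)
        qed
        ultimately show ?thesis by (metis imageI)
      qed
    qed
  qed
  hence "card E = card (near m n c)" using card_image[OF inj] by simp
  thus ?thesis by (simp add: E_def)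
qed

lemma pair_corr_farey:
  assumes "n > 0" "c > 0" "c \<le> (real n)\<^sup>2"
  shows "pair_corr (farey_coprime m n) {0..<c * real (card (farey_coprime m n)) / (real n)\<^sup>2}
       = (real (card (near m n c)) / (real n)\<^sup>2) / (real (card (farey_coprime m n)) / (real n)\<^sup>2)"
  unfolding pair_corr_def card_close_pairs[OF assms] using assms by simp

section \<open>The limiting distribution and its density\<close>

definition corr_dens :: "nat \<Rightarrow> real \<Rightarrow> real" where
  "corr_dens m x = real (totient m) / real m * (C m / x\<^sup>2) *
     (\<Sum>D | 1 \<le> D \<and> real D \<le> 2 * x / C m. weight m D * ln (2 * x / (C m * real D)))"

text \<open>By N ~ C n^2 / 2, the scaled length x corresponds to c = 2 x / C, and dividing the count
  by N instead of n^2 brings in the factor 2 / C.\<close>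

definition corr_dist :: "nat \<Rightarrow> real \<Rightarrow> real" where
  "corr_dist m x = 2 / C m * near_lim m (2 * x / C m)"

text \<open>As a function of X > a, \<open>Phi (a / X) / a\<close> has derivative ln (X / a) / X^2;
  this is the source of the logarithm and of the inverse square in the density.\<close>

lemma has_integral_log_kernel:
  fixes a X :: real
  assumes "0 < a" "a \<le> X"
  shows "((\<lambda>x. if x \<le> a then 0 else ln (x / a) / x\<^sup>2) has_integral Phi (a / X) / a) {0..X}"
proof -
  define F where "F = (\<lambda>x. - (ln x - ln a + 1) / x)"
  have "((\<lambda>x. if x \<le> a then 0 else ln (x / a) / x\<^sup>2) has_integral (F X - F a)) {0..X}"
  proof (rule has_integral_zero_then_antiderivative)
    fix x assume x: "x \<in> {a..X}"
    hence "x > 0" using assms by auto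
    have "(F has_real_derivative (ln x - ln a) / x\<^sup>2) (at x within {a..X})"
      unfolding F_def using \<open>x > 0\<close>
      by (auto intro!: derivative_eq_intros simp: field_simps power2_eq_square)
    also have "(ln x - ln a) / x\<^sup>2 = (if x \<le> a then 0 else ln (x / a) / x\<^sup>2)"
      using x assms by (auto simp: ln_div)
    finally show "(F has_real_derivative (if x \<le> a then 0 else ln (x / a) / x\<^sup>2)) (at x within {a..X})" .
  qed (use assms in auto)
  also have "F X - F a = Phi (a / X) / a"
    using assms by (auto simp: F_def Phi_def ln_div field_simps)
  finally show ?thesis .
qed

text \<open>The range of D in \<open>corr_dens\<close> depends on x. Setting each kernel to 0 up to
  \<open>a D\<close>, the point where 2 x / C reaches D, allows one fixed range for all x \<le> X
  and termwise integration.\<close>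

lemma corr_dens_has_integral:
  assumes "m > 0" "X \<ge> 0"
  shows "(corr_dens m has_integral corr_dist m X) {0..X}"
proof -
  define \<kappa> where "\<kappa> = real (totient m) / real m * C m"
  define K where "K = nat \<lfloor>2 * X / C m\<rfloor>"
  define a where "a = (\<lambda>D. real D * C m / 2)"
  have C: "C m > 0" using C_pos[OF assms(1)] .
  have a: "0 < a D" "a D \<le> X" if "D \<in> {1..K}" for D
  proof -
    have "real D \<le> 2 * X / C m" using that le_nat_floor_iff[of D "2 * X / C m"] by (auto simp: K_def)
    thus "0 < a D" "a D \<le> X" using that C by (auto simp: a_def field_simps)
  qed
  have "((\<lambda>x. \<kappa> * (\<Sum>D\<in>{1..K}. weight m D * (if x \<le> a D then 0 else ln (x / a D) / x\<^sup>2)))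
     has_integral \<kappa> * (\<Sum>D\<in>{1..K}. weight m D * (Phi (a D / X) / a D))) {0..X}"
    using a by (intro has_integral_mult_right has_integral_sum has_integral_log_kernel) auto
  also have "\<kappa> * (\<Sum>D\<in>{1..K}. weight m D * (Phi (a D / X) / a D)) = corr_dist m X"
  proof -
    have "\<kappa> * (\<Sum>D\<in>{1..K}. weight m D * (Phi (a D / X) / a D))
        = \<kappa> * (\<Sum>D\<in>{1..K}. 2 / C m * (weight m D / real D * Phi (real D / (2 * X / C m))))"
      using C by (intro arg_cong[where f = "\<lambda>x. \<kappa> * x"] sum.cong) (auto simp: a_def field_simps)
    also have "\<dots> = 2 / C m * (\<kappa> * (\<Sum>D\<in>{1..K}. weight m D / real D * Phi (real D / (2 * X / C m))))"
      by (simp only: sum_distrib_left[symmetric] mult.left_commute)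
    finally show ?thesis by (simp only: corr_dist_def near_lim_def \<kappa>_def K_def)
  qed
  finally show ?thesis
  proof (rule has_integral_eq[rotated])
    fix x assume x: "x \<in> {0..X}"
    have iff: "real D \<le> 2 * x / C m \<longleftrightarrow> a D \<le> x" for D
      using C by (auto simp: a_def field_simps)
    have sub: "{D. 1 \<le> D \<and> real D \<le> 2 * x / C m} \<subseteq> {1..K}"
    proof
      fix D assume D: "D \<in> {D. 1 \<le> D \<and> real D \<le> 2 * x / C m}"
      have "2 * x / C m \<le> 2 * X / C m" using x C by (intro divide_right_mono) auto
      hence "real D \<le> 2 * X / C m" using D by simp
      thus "D \<in> {1..K}" using D by (auto simp: K_def le_nat_floor)
    qed
    have "(\<Sum>D\<in>{1..K}. weight m D * (if x \<le> a D then 0 else ln (x / a D) / x\<^sup>2))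
        = (\<Sum>D | 1 \<le> D \<and> real D \<le> 2 * x / C m. weight m D * (ln (2 * x / (C m * real D)) / x\<^sup>2))"
    proof (rule sum.mono_neutral_cong_right)
      show "\<forall>i\<in>{1..K} - {D. 1 \<le> D \<and> real D \<le> 2 * x / C m}.
          weight m i * (if x \<le> a i then 0 else ln (x / a i) / x\<^sup>2) = 0"
        unfolding iff by auto
      fix D assume D: "D \<in> {D. 1 \<le> D \<and> real D \<le> 2 * x / C m}"
      hence "a D \<le> x" "a D > 0" using iff C by (auto simp: a_def)
      have eq: "2 * x / (C m * real D) = x / a D" by (simp add: a_def mult.commute)
      show "weight m D * (if x \<le> a D then 0 else ln (x / a D) / x\<^sup>2)
          = weight m D * (ln (2 * x / (C m * real D)) / x\<^sup>2)"
        unfolding eq using \<open>a D \<le> x\<close> \<open>a D > 0\<close> by auto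
    qed (use sub in auto)
    thus "\<kappa> * (\<Sum>D\<in>{1..K}. weight m D * (if x \<le> a D then 0 else ln (x / a D) / x\<^sup>2)) = corr_dens m x"
      by (simp add: corr_dens_def \<kappa>_def sum_divide_distrib[symmetric])
  qed
qed

lemma corr_dens_nonneg:
  assumes "m > 0"
  shows "corr_dens m x \<ge> 0"
  unfolding corr_dens_def using C_pos[OF assms]
  by (intro mult_nonneg_nonneg sum_nonneg ln_ge_zero) (auto simp: weight_def field_simps)

text \<open>As an indefinite integral, \<open>corr_dist\<close> is continuous also at the points
  where a new D enters the sum in \<open>near_lim\<close>.\<close>

lemma continuous_on_corr_dist:
  assumes "m > 0"
  shows "continuous_on {0..X} (corr_dist m)"
proof (cases "X \<ge> 0")
  case True
  have "continuous_on {0..X} (\<lambda>x. integral {0..x} (corr_dens m))"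
    using corr_dens_has_integral[OF assms True] by (intro indefinite_integral_continuous_1) blast
  also have "?this \<longleftrightarrow> ?thesis"
    by (intro continuous_on_cong refl integral_unique corr_dens_has_integral assms) auto
  finally show ?thesis .
qed auto

lemma isCont_corr_dist:
  assumes "m > 0" "x > 0"
  shows "isCont (corr_dist m) x"
proof -
  have "continuous_on {0<..<x + 1} (corr_dist m)"
    by (rule continuous_on_subset[OF continuous_on_corr_dist[OF assms(1), of "x + 1"]]) auto
  thus ?thesis using assms by (simp add: continuous_on_eq_continuous_at)
qed

text \<open>The counts are known for windows [0, c N / n^2) with c = 2 y / C fixed, whose right end
  moves with n and tends to y. For y < x such a window eventually lies inside [0, x], for y > x it
  eventually contains [0, x]; continuity of \<open>corr_dist\<close> at x closes the gap.\<close>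

lemma pair_corr_farey_asymp:
  assumes "m > 0" "x \<ge> 0"
  shows "(\<lambda>n. pair_corr (farey_coprime m n) {0..x}) \<longlonglongrightarrow> corr_dist m x"
proof (cases "x = 0")
  case True
  \<comment> \<open>The case 0 leaves no room for 0 < y < x, but it is exact: distinct fractions in
    (0, 1] never differ by an integer.\<close>
  have "pair_corr (farey_coprime m n) {0..x} = 0" for n
  proof -
    have "{(x, y). x \<in> farey_coprime m n \<and> y \<in> farey_coprime m n \<and> y \<noteq> x \<and>
       (\<exists>t\<in>{0..0::real}. \<exists>k::int. y - x = 1 / real (card (farey_coprime m n)) * t + of_int k)} = {}"
    proof (safe)
      fix x y t and k :: int
      assume *: "x \<in> farey_coprime m n" "y \<in> farey_coprime m n" "y \<noteq> x" "t \<in> {0..0::real}"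
        "y - x = 1 / real (card (farey_coprime m n)) * t + of_int k"
      have "-1 < y - x" "y - x < 1" 
        using farey_coprime_bounds[OF *(1)] farey_coprime_bounds[OF *(2)] by linarith+
      hence "k = 0" using *(4,5) by simp
      thus "(x, y) \<in> {}" using * by simp
    qed
    thus ?thesis
      unfolding pair_corr_def True by (simp only: card.empty of_nat_0 mult_zero_right)
  qed
  moreover have "corr_dist m x = 0" by (simp add: corr_dist_def near_lim_def True)
  ultimately show ?thesis by simp
next
  case False
  hence x: "x > 0" using assms by simp
  have C: "C m > 0" using C_pos[OF assms(1)] .
  define N where "N = (\<lambda>n. real (card (farey_coprime m n)))"
  define P where "P = (\<lambda>y n. pair_corr (farey_coprime m n) {0..<2 * y / C m * N n / (real n)\<^sup>2})"
  have Nlim: "(\<lambda>n. N n / (real n)\<^sup>2) \<longlonglongrightarrow> C m / 2"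
    unfolding N_def by (rule card_farey_coprime_asymp[OF assms(1)])
  have P: "P y \<longlonglongrightarrow> corr_dist m y" if "y > 0" for y
  proof -
    have c: "2 * y / C m > 0" using that C by simp
    have "(\<lambda>n. (real (card (near m n (2 * y / C m))) / (real n)\<^sup>2) / (N n / (real n)\<^sup>2))
       \<longlonglongrightarrow> near_lim m (2 * y / C m) / (C m / 2)"
      using C c assms by (intro tendsto_divide card_near_asymp Nlim) auto
    moreover have "\<forall>\<^sub>F n in sequentially.
        (real (card (near m n (2 * y / C m))) / (real n)\<^sup>2) / (N n / (real n)\<^sup>2) = P y n"
    proof -
      have "\<forall>\<^sub>F n in sequentially. 2 * y / C m \<le> real n"
        using filterlim_real_sequentially by (simp add: filterlim_at_top)
      thus ?thesis using eventually_gt_at_top[of 0]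
      proof eventually_elim
        case (elim n)
        have "real n \<le> (real n)\<^sup>2" using elim by (simp add: power2_eq_square)
        hence "2 * y / C m \<le> (real n)\<^sup>2" using elim(1) by linarith
        thus ?case unfolding P_def N_def using pair_corr_farey[OF elim(2) c] by simp
      qed
    qed
    ultimately have "P y \<longlonglongrightarrow> near_lim m (2 * y / C m) / (C m / 2)"
      by (rule Lim_transform_eventually)
    thus ?thesis by (simp add: corr_dist_def mult.commute)
  qed
  have scale: "(\<lambda>n. 2 * y / C m * N n / (real n)\<^sup>2) \<longlonglongrightarrow> y" for y
    using tendsto_mult_left[OF Nlim, of "2 * y / C m"] C by simp
  show ?thesis
  proof (rule order_tendstoI)
    fix l assume l: "l < corr_dist m x"
    have "\<forall>\<^sub>F y in at_left x. l < corr_dist m y"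
      using isCont_corr_dist[OF assms(1) x] l
      by (auto simp: isCont_def filterlim_at_split dest: order_tendstoD(1))
    moreover have "\<forall>\<^sub>F y in at_left x. y \<in> {0<..<x}" using x by (rule eventually_at_left_real)
    ultimately have "\<forall>\<^sub>F y in at_left x. l < corr_dist m y \<and> y \<in> {0<..<x}"
      by eventually_elim auto
    then obtain y where y: "l < corr_dist m y" "0 < y" "y < x"
      using eventually_happens by (metis (no_types, lifting) greaterThanLessThan_iff trivial_limit_at_left_real)
    have "\<forall>\<^sub>F n in sequentially. l < P y n" using P[of y] y by (intro order_tendstoD(1)) auto
    moreover have "\<forall>\<^sub>F n in sequentially. 2 * y / C m * N n / (real n)\<^sup>2 < x"
      using scale[of y] y(3) by (rule order_tendstoD(2))
    ultimately show "\<forall>\<^sub>F n in sequentially. l < pair_corr (farey_coprime m n) {0..x}"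
    proof eventually_elim
      case (elim n)
      have "P y n \<le> pair_corr (farey_coprime m n) {0..x}"
        unfolding P_def using elim by (intro pair_corr_mono finite_farey_coprime) auto
      thus ?case using elim by simp
    qed
  next
    fix l assume l: "corr_dist m x < l"
    have "\<forall>\<^sub>F y in at_right x. corr_dist m y < l"
      using isCont_corr_dist[OF assms(1) x] l
      by (auto simp: isCont_def filterlim_at_split dest: order_tendstoD(2))
    moreover have "\<forall>\<^sub>F y in at_right x. y \<in> {x<..<x + 1}" by (rule eventually_at_right_real) simp
    ultimately have "\<forall>\<^sub>F y in at_right x. corr_dist m y < l \<and> y \<in> {x<..<x + 1}"
      by eventually_elim auto
    then obtain y where y: "corr_dist m y < l" "x < y"
      using eventually_happens by (metis (no_types, lifting) greaterThanLessThan_iff trivial_limit_at_right_real)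
    have "\<forall>\<^sub>F n in sequentially. P y n < l" using P[of y] y x by (intro order_tendstoD(2)) auto
    moreover have "\<forall>\<^sub>F n in sequentially. x < 2 * y / C m * N n / (real n)\<^sup>2"
      using scale[of y] y(2) by (rule order_tendstoD(1))
    ultimately show "\<forall>\<^sub>F n in sequentially. pair_corr (farey_coprime m n) {0..x} < l"
    proof eventually_elim
      case (elim n)
      have "pair_corr (farey_coprime m n) {0..x} \<le> P y n"
        unfolding P_def using elim by (intro pair_corr_mono finite_farey_coprime) auto
      thus ?case using elim by simp
    qed
  qed
qed

lemma filterlim_card_farey_coprime:
  assumes "m > 0"
  shows "filterlim (\<lambda>n. real (card (farey_coprime m n))) at_top sequentially"
proof -
  have "filterlim (\<lambda>n. real (card (farey_coprime m n)) / (real n)\<^sup>2 * (real n)\<^sup>2) at_top sequentially"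
    using C_pos[OF assms] filterlim_real_sequentially
    by (intro filterlim_tendsto_pos_mult_at_top[OF card_farey_coprime_asymp[OF assms]]
          filterlim_pow_at_top) auto
  thus ?thesis
  proof (rule filterlim_mono_eventually)
    show "\<forall>\<^sub>F n in sequentially. real (card (farey_coprime m n)) / (real n)\<^sup>2 * (real n)\<^sup>2 = real (card (farey_coprime m n))"
      using eventually_gt_at_top[of 0] by eventually_elim simp
  qed auto
qed

lemma pair_corr_farey_convergent:
  assumes "m > 0" "is_interval I" "bounded I"
  shows "convergent (\<lambda>n. pair_corr (farey_coprime m n) I)"
proof (rule convergent_on_bounded_intervals[where G = "corr_dist m"])
  show "\<forall>\<^sub>F n in sequentially. \<forall>I J. I \<inter> J = {} \<longrightarrow> I \<union> J \<subseteq> {-L..L} \<longrightarrow>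
     pair_corr (farey_coprime m n) (I \<union> J) = pair_corr (farey_coprime m n) I + pair_corr (farey_coprime m n) J" for L
  proof -
    have "\<forall>\<^sub>F n in sequentially. 2 * L < real (card (farey_coprime m n))"
      using filterlim_card_farey_coprime[OF assms(1)] by (simp add: filterlim_at_top_dense)
    thus ?thesis
      by eventually_elim (use pair_corr_Un[OF finite_farey_coprime] in blast)
  qed
  show "corr_dist m 0 = 0" by (simp add: corr_dist_def near_lim_def)
  show "(corr_dist m \<longlongrightarrow> corr_dist m x) (at_left x)" if "x > 0" for x
    using isCont_corr_dist[OF assms(1) that] by (auto simp: isCont_def filterlim_at_split)
qed (use assms pair_corr_farey_asymp in \<open>auto simp: pair_corr_nonneg pair_corr_uminus\<close>)

lemma pair_correlation_function_farey:
  assumes "m > 0"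
  shows "pair_correlation_function (farey_coprime m) (corr_dens m)"
  unfolding pair_correlation_function_def pair_correlation_measure_def
\<comment> \<open>Where the sequence diverges \<open>lim\<close> is an unspecified value, but on
  bounded intervals convergence has been shown.\<close>
proof (intro exI[of _ "\<lambda>I. lim (\<lambda>n. pair_corr (farey_coprime m n) I)"] conjI allI impI)
  fix I :: "real set" assume I: "is_interval I \<and> bounded I"
  show "(\<lambda>n. pair_corr (farey_coprime m n) I) \<longlonglongrightarrow> lim (\<lambda>n. pair_corr (farey_coprime m n) I)"
    using pair_corr_farey_convergent[OF assms] I by (simp add: convergent_LIMSEQ_iff)
next
  fix x :: real assume x: "x > 0"
  have int: "(corr_dens m has_integral corr_dist m x) {0..x}"
    using corr_dens_has_integral[OF assms] x by simp
  show "corr_dens m absolutely_integrable_on {0..x}"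
    using int corr_dens_nonneg[OF assms] by (intro nonnegative_absolutely_integrable_1) auto
  show "lim (\<lambda>n. pair_corr (farey_coprime m n) {0..x}) = integral {0..x} (corr_dens m)"
    using limI[OF pair_corr_farey_asymp[OF assms, of x]] x integral_unique[OF int] by simp
qed (auto simp: incseq_farey_coprime finite_farey_coprime)

theorem theorem1:
  fixes m :: nat
  assumes "m > 0"
  shows "(\<exists>g. pair_correlation_function (farey_coprime m) g \<and>
            (\<forall>x>0. g x = real (totient m) / real m * (C m / x\<^sup>2) *
               (\<Sum>\<Delta> | 1 \<le> \<Delta> \<and> real \<Delta> \<le> 2 * x / C m.
                  real (totient \<Delta>) * (real (gcd \<Delta> m) / real (totient (gcd \<Delta> m))) *
                  ln (2 * x / (C m * real \<Delta>)))))
       \<and> convergent_prod (\<lambda>p. if prime p \<and> \<not> p dvd m then 1 - 1 / (real p)\<^sup>2 else 1)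
       \<and> C m = real (totient m) / real m *
           (\<Prod>p. if prime p \<and> \<not> p dvd m then 1 - 1 / (real p)\<^sup>2 else 1)"
proof (intro conjI exI[of _ "corr_dens m"] allI impI)
  show "pair_correlation_function (farey_coprime m) (corr_dens m)"
    by (rule pair_correlation_function_farey[OF assms])
  have eq: "euler_factor m = (\<lambda>p. if prime p \<and> \<not> p dvd m then 1 - 1 / (real p)\<^sup>2 else 1)"
    by (simp add: euler_factor_def fun_eq_iff)
  show "convergent_prod (\<lambda>p. if prime p \<and> \<not> p dvd m then 1 - 1 / (real p)\<^sup>2 else 1)"
    using convergent_prod_euler_factor[of m] unfolding eq .
  show "C m = real (totient m) / real m *
           (\<Prod>p. if prime p \<and> \<not> p dvd m then 1 - 1 / (real p)\<^sup>2 else 1)"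
    using C_eq_prodinf[OF assms] unfolding eq .
qed (simp add: corr_dens_def weight_def)

end
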